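(* Let $(M,P,g)$ be a Riemannian almost product manifold with $\mathrm{tr}\,P=0$, $\dim M=2n$, $n\ge2$, belonging to the class $\overline{\mathcal W}_3\cup\overline{\mathcal W}_6$, and suppose that its associated 1-form $\theta$ is closed. If $R'$ is the curvature tensor of type $(0,4)$ of the canonical connection on $(M,P,g)$, then $A(R')=A(K)$.
   Context: A Riemannian almost product manifold $(M,P,g)$ is a differentiable manifold $M$ with a Riemannian metric $g$ and a $(1,1)$-tensor field $P$ such that $P^2x=x$ and $g(Px,Py)=g(x,y)$; here $\mathrm{tr}\,P=0$ and $\dim M=2n$. $x,y,z,w$ denote arbitrary vector fields (or tangent vectors at a point). $\nabla$ is the Levi-Civita connection of $g$, $F(x,y,z)=g((\nabla_xP)y,z)$, and the associated 1-form is $\theta(x)=g^{ij}F(e_i,e_j,x)$ for a local basis $\{e_i\}$. Class $\overline{\mathcal W}_3$: $F(x,y,z)=\frac1{2n}\{[g(x,y)+g(x,Py)]\theta(z)+[g(x,z)+g(x,Pz)]\theta(y)\}$ and $\theta(Px)=-\theta(x)$. Class $\overline{\mathcal W}_6$: $F(x,y,z)=\frac1{2n}\{[g(x,y)-g(x,Py)]\theta(z)+[g(x,z)-g(x,Pz)]\theta(y)\}$ and $\theta(Px)=\theta(x)$. $(M,P,g)\in\overline{\mathcal W}_3\cup\overline{\mathcal W}_6$ means that $(M,P,g)$ belongs to one of these two classes. The sign $\varepsilon=\pm1$ is the one with $\theta(Pz)=\varepsilon\theta(z)$, i.e. $\varepsilon=-1$ on $\overline{\mathcal W}_3$ and $\varepsilon=1$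 on $\overline{\mathcal W}_6$. A natural connection is a linear connection $\nabla'$ with $\nabla'P=\nabla'g=0$; on these manifolds the natural connections considered are those of the 2-parameter family ($\lambda,\mu\in\mathbb R$) whose torsion $T(x,y,z)=g(T(x,y),z)$ is $$T(x,y,z)=\tfrac1{2n}\{g(y,z)\theta(Px)-g(x,z)\theta(Py)\}+\lambda\{g(y,z)\theta(x)-g(x,z)\theta(y)+g(y,Pz)\theta(Px)-g(x,Pz)\theta(Py)\}+\mu\{g(y,Pz)\theta(x)-g(x,Pz)\theta(y)+g(y,z)\theta(Px)-g(x,z)\theta(Py)\}.$$ The canonical connection is the member of this family with $\lambda=0$, $\mu=-\frac1{4n}$. Curvature: $R(x,y)z=\nabla_x\nabla_yz-\nabla_y\nabla_xz-\nabla_{[x,y]}z$, $R(x,y,z,w)=g(R(x,y)z,w)$, and $R'$ is defined in the same way from $\nabla'$. The tensor $K$ is $K(x,y,z,w)=\frac12[R(x,y,z,w)+R(x,y,Pz,Pw)]$. A curvature-like tensor is a $(0,4)$-tensor $L$ with $L(x,y,z,w)=-L(y,x,z,w)=-L(x,y,w,z)$ and $L(x,y,z,w)+L(y,z,x,w)+L(z,x,y,w)=0$; it is a Riemannian $P$-tensor if also $L(x,y,Pz,Pw)=L(x,y,z,w)$. (Under the hypotheses, $K$ and $R'$ are Riemannian $P$-tensors.) For such $L$: $\rho(L)(y,z)=g^{ij}L(e_i,y,z,e_j)$ and $\tau(L)=g^{ij}\rho(L)(e_i,e_j)$. For a $(0,2)$-tensor $S$: $\psi_1(S)(x,y,z,w)=g(y,z)S(x,w)-g(x,z)S(y,w)+S(y,z)g(x,w)-S(x,z)g(y,w)$,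 $\psi_2(S)(x,y,z,w)=\psi_1(S)(x,y,Pz,Pw)$. With $\widetilde g(x,y)=g(x,Py)$: $\pi_1=\frac12\psi_1(g)$, $\pi_2=\frac12\psi_2(g)$, $\pi_3=\psi_1(\widetilde g)=\psi_2(\widetilde g)$. For a Riemannian $P$-tensor $L$, $$A(L)=L-\frac{\tau(L)(\pi_1+\pi_2-\varepsilon\pi_3)}{4n(n-1)}.$$ *)

theory Defs
  imports "HOL-Analysis.Analysis"
begin

section \<open>Smooth functions and smooth manifolds\<close>

fun C_k_on :: "nat \<Rightarrow> 'a::euclidean_space set \<Rightarrow> ('a \<Rightarrow> 'b::real_normed_vector) \<Rightarrow> bool" where
  "C_k_on 0 S f \<longleftrightarrow> continuous_on S f"
| "C_k_on (Suc k) S f \<longleftrightarrow>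
     (\<forall>x\<in>S. f differentiable (at x)) \<and>
     (\<forall>b\<in>Basis. C_k_on k S (\<lambda>x. frechet_derivative f (at x) b))"

text \<open>Only meant for open sets, since the derivatives are unrestricted ones.\<close>

definition smooth_on :: "'a::euclidean_space set \<Rightarrow> ('a \<Rightarrow> 'b::real_normed_vector) \<Rightarrow> bool" where
  "smooth_on S f \<longleftrightarrow> (\<forall>k. C_k_on k S f)"

text \<open>A chart is its domain together with its coordinate map. The manifold is the whole type
  \<^typ>\<open>'m\<close>, and its dimension is \<^term>\<open>CARD('d)\<close>. The atlas need not be maximal.\<close>

type_synonym ('m, 'd) chart = "'m set \<times> ('m \<Rightarrow> real ^ 'd)"

definition smooth_atlas ::
  "('m::{t2_space, second_countable_topology}, 'd::finite) chart set \<Rightarrow> bool" where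
  "smooth_atlas \<A> \<longleftrightarrow>
     (\<forall>(U, \<phi>)\<in>\<A>. open U \<and> open (\<phi> ` U) \<and> homeomorphism U (\<phi> ` U) \<phi> (inv_into U \<phi>)) \<and>
     (\<forall>(U, \<phi>)\<in>\<A>. \<forall>(V, \<psi>)\<in>\<A>. smooth_on (\<phi> ` (U \<inter> V)) (\<psi> \<circ> inv_into U \<phi>)) \<and>
     (\<Union>(U, \<phi>)\<in>\<A>. U) = UNIV"

definition smooth_fun :: "('m::topological_space, 'd::finite) chart set \<Rightarrow> 'm set \<Rightarrow> ('m \<Rightarrow> real) \<Rightarrow> bool" where
  "smooth_fun \<A> W f \<longleftrightarrow> (\<forall>(U, \<phi>)\<in>\<A>. smooth_on (\<phi> ` (U \<inter> W)) (f \<circ> inv_into U \<phi>))"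

definition smooth_near :: "('m::topological_space, 'd::finite) chart set \<Rightarrow> 'm \<Rightarrow> ('m \<Rightarrow> real) \<Rightarrow> bool" where
  "smooth_near \<A> p f \<longleftrightarrow> (\<exists>W. open W \<and> p \<in> W \<and> smooth_fun \<A> W f)"

section \<open>Tangent vectors and vector fields\<close>

text \<open>A tangent vector at \<open>p\<close> is a directional derivative operator on the functions that are smooth
  near \<open>p\<close>. It is made \<open>0\<close> on all other functions, so that equality of tangent vectors is
  equality of HOL functions. Linear combinations are taken pointwise in \<open>f\<close>.\<close>

type_synonym 'm tvec = "('m \<Rightarrow> real) \<Rightarrow> real"
type_synonym 'm vfield = "'m \<Rightarrow> 'm tvec"

definition coord_tangent ::
  "('m::topological_space, 'd::finite) chart set \<Rightarrow> ('m, 'd) chart \<Rightarrow> 'm \<Rightarrow> real ^ 'd \<Rightarrow> 'm tvec" where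
  "coord_tangent \<A> c p a =
     (\<lambda>f. if smooth_near \<A> p f
          then frechet_derivative (f \<circ> inv_into (fst c) (snd c)) (at (snd c p)) a else 0)"

definition tangent_space :: "('m::topological_space, 'd::finite) chart set \<Rightarrow> 'm \<Rightarrow> 'm tvec set" where
  "tangent_space \<A> p = {coord_tangent \<A> c p a | c a. c \<in> \<A> \<and> p \<in> fst c}"

definition vector_field :: "('m::topological_space, 'd::finite) chart set \<Rightarrow> 'm set \<Rightarrow> 'm vfield \<Rightarrow> bool" where
  "vector_field \<A> W X \<longleftrightarrow>
     (\<forall>p\<in>W. X p \<in> tangent_space \<A> p) \<and>
     (\<forall>V f. open V \<and> V \<subseteq> W \<and> smooth_fun \<A> V f \<longrightarrow> smooth_fun \<A> V (\<lambda>p. X p f))"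

definition bracket ::
  "('m::topological_space, 'd::finite) chart set \<Rightarrow> 'm vfield \<Rightarrow> 'm vfield \<Rightarrow> 'm vfield" where
  "bracket \<A> X Y =
     (\<lambda>p f. if smooth_near \<A> p f then X p (\<lambda>q. Y q f) - Y p (\<lambda>q. X q f) else 0)"

text \<open>Some smooth vector field near \<open>p\<close> with value \<open>v\<close> at \<open>p\<close>. Below it is used only in
  expressions that are tensorial, i.e. whose value at \<open>p\<close> does not depend on the extension.\<close>

definition extend :: "('m::topological_space, 'd::finite) chart set \<Rightarrow> 'm \<Rightarrow> 'm tvec \<Rightarrow> 'm vfield" where
  "extend \<A> p v = (SOME X. \<exists>W. open W \<and> p \<in> W \<and> vector_field \<A> W X \<and> X p = v)"

definition tangent_basis ::
  "('m::topological_space, 'd::finite) chart set \<Rightarrow> 'm \<Rightarrow> ('d \<Rightarrow> 'm tvec) \<Rightarrow> bool" where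
  "tangent_basis \<A> p e \<longleftrightarrow>
     (\<forall>i. e i \<in> tangent_space \<A> p) \<and>
     (\<forall>v\<in>tangent_space \<A> p. \<exists>!c::real ^ 'd. v = (\<lambda>f. \<Sum>i\<in>UNIV. c $ i * e i f))"

definition some_basis :: "('m::topological_space, 'd::finite) chart set \<Rightarrow> 'm \<Rightarrow> 'd \<Rightarrow> 'm tvec" where
  "some_basis \<A> p = (SOME e. tangent_basis \<A> p e)"

section \<open>Riemannian almost product manifolds\<close>

definition riemannian_metric ::
  "('m::topological_space, 'd::finite) chart set \<Rightarrow> ('m \<Rightarrow> 'm tvec \<Rightarrow> 'm tvec \<Rightarrow> real) \<Rightarrow> bool" where
  "riemannian_metric \<A> g \<longleftrightarrow>
     (\<forall>p. \<forall>u\<in>tangent_space \<A> p. \<forall>v\<in>tangent_space \<A> p. \<forall>w\<in>tangent_space \<A> p. \<forall>a b.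
        g p (\<lambda>f. a * u f + b * v f) w = a * g p u w + b * g p v w) \<and>
     (\<forall>p. \<forall>u\<in>tangent_space \<A> p. \<forall>v\<in>tangent_space \<A> p. g p u v = g p v u) \<and>
     (\<forall>p. \<forall>u\<in>tangent_space \<A> p. u \<noteq> (\<lambda>f. 0) \<longrightarrow> g p u u > 0) \<and>
     (\<forall>W X Y. open W \<and> vector_field \<A> W X \<and> vector_field \<A> W Y \<longrightarrow>
        smooth_fun \<A> W (\<lambda>p. g p (X p) (Y p)))"

definition endomorphism_field ::
  "('m::topological_space, 'd::finite) chart set \<Rightarrow> ('m \<Rightarrow> 'm tvec \<Rightarrow> 'm tvec) \<Rightarrow> bool" where
  "endomorphism_field \<A> P \<longleftrightarrow>
     (\<forall>p. \<forall>u\<in>tangent_space \<A> p. P p u \<in> tangent_space \<A> p) \<and>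
     (\<forall>p. \<forall>u\<in>tangent_space \<A> p. \<forall>v\<in>tangent_space \<A> p. \<forall>a b.
        P p (\<lambda>f. a * u f + b * v f) = (\<lambda>f. a * P p u f + b * P p v f)) \<and>
     (\<forall>W X. open W \<and> vector_field \<A> W X \<longrightarrow> vector_field \<A> W (\<lambda>p. P p (X p)))"

definition riemannian_almost_product ::
  "('m::{t2_space, second_countable_topology}, 'd::finite) chart set \<Rightarrow> ('m \<Rightarrow> 'm tvec \<Rightarrow> 'm tvec) \<Rightarrow>
   ('m \<Rightarrow> 'm tvec \<Rightarrow> 'm tvec \<Rightarrow> real) \<Rightarrow> bool" where
  "riemannian_almost_product \<A> P g \<longleftrightarrow>
     smooth_atlas \<A> \<and> riemannian_metric \<A> g \<and> endomorphism_field \<A> P \<and>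
     (\<forall>p. \<forall>x\<in>tangent_space \<A> p. P p (P p x) = x) \<and>
     (\<forall>p. \<forall>x\<in>tangent_space \<A> p. \<forall>y\<in>tangent_space \<A> p. g p (P p x) (P p y) = g p x y)"

definition endo_trace ::
  "('m::topological_space, 'd::finite) chart set \<Rightarrow> 'm \<Rightarrow> ('m tvec \<Rightarrow> 'm tvec) \<Rightarrow> real" where
  "endo_trace \<A> p Q = (let e = some_basis \<A> p in
     \<Sum>i\<in>UNIV. (THE c::real ^ 'd. Q (e i) = (\<lambda>f. \<Sum>j\<in>UNIV. c $ j * e j f)) $ i)"

text \<open>The contraction \<open>g\<^sup>i\<^sup>j B(e\<^sub>i, e\<^sub>j)\<close> at \<open>p\<close>.\<close>

definition metric_trace ::
  "('m::topological_space, 'd::finite) chart set \<Rightarrow> ('m \<Rightarrow> 'm tvec \<Rightarrow> 'm tvec \<Rightarrow> real) \<Rightarrow> 'm \<Rightarrow>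
   ('m tvec \<Rightarrow> 'm tvec \<Rightarrow> real) \<Rightarrow> real" where
  "metric_trace \<A> g p B = (let e = some_basis \<A> p;
       G = (\<chi> i j. g p (e i) (e j)) :: real ^ 'd ^ 'd
     in \<Sum>i\<in>UNIV. \<Sum>j\<in>UNIV. matrix_inv G $ i $ j * B (e i) (e j))"

section \<open>Linear connections\<close>

text \<open>\<open>D p v Y\<close> is the covariant derivative at \<open>p\<close>, in the direction of the tangent vector \<open>v\<close>,
  of a vector field \<open>Y\<close> defined near \<open>p\<close>.\<close>

type_synonym 'm connection = "'m \<Rightarrow> 'm tvec \<Rightarrow> 'm vfield \<Rightarrow> 'm tvec"

definition cov :: "'m connection \<Rightarrow> 'm vfield \<Rightarrow> 'm vfield \<Rightarrow> 'm vfield" where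
  "cov D X Y = (\<lambda>p. D p (X p) Y)"

definition linear_connection ::
  "('m::topological_space, 'd::finite) chart set \<Rightarrow> 'm connection \<Rightarrow> bool" where
  "linear_connection \<A> D \<longleftrightarrow>
     (\<forall>W X Y. open W \<and> vector_field \<A> W X \<and> vector_field \<A> W Y \<longrightarrow> vector_field \<A> W (cov D X Y)) \<and>
     (\<forall>W Y p. open W \<and> p \<in> W \<and> vector_field \<A> W Y \<longrightarrow>
        (\<forall>u\<in>tangent_space \<A> p. \<forall>v\<in>tangent_space \<A> p. \<forall>a b.
           D p (\<lambda>f. a * u f + b * v f) Y = (\<lambda>f. a * D p u Y f + b * D p v Y f))) \<and>
     (\<forall>W Y Z p. open W \<and> p \<in> W \<and> vector_field \<A> W Y \<and> vector_field \<A> W Z \<longrightarrow>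
        (\<forall>v\<in>tangent_space \<A> p.
           D p v (\<lambda>q f. Y q f + Z q f) = (\<lambda>f. D p v Y f + D p v Z f))) \<and>
     (\<forall>W Y h p. open W \<and> p \<in> W \<and> vector_field \<A> W Y \<and> smooth_fun \<A> W h \<longrightarrow>
        (\<forall>v\<in>tangent_space \<A> p.
           D p v (\<lambda>q f. h q * Y q f) = (\<lambda>f. v h * Y p f + h p * D p v Y f))) \<and>
     (\<forall>W Y Z p. open W \<and> p \<in> W \<and> vector_field \<A> W Y \<and> vector_field \<A> W Z \<and> (\<forall>q\<in>W. Y q = Z q) \<longrightarrow>
        (\<forall>v\<in>tangent_space \<A> p. D p v Y = D p v Z))"

definition torsion_field ::
  "('m::topological_space, 'd::finite) chart set \<Rightarrow> 'm connection \<Rightarrow> 'm vfield \<Rightarrow> 'm vfield \<Rightarrow> 'm vfield" where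
  "torsion_field \<A> D X Y = (\<lambda>p f. cov D X Y p f - cov D Y X p f - bracket \<A> X Y p f)"

definition curvature_field ::
  "('m::topological_space, 'd::finite) chart set \<Rightarrow> 'm connection \<Rightarrow>
   'm vfield \<Rightarrow> 'm vfield \<Rightarrow> 'm vfield \<Rightarrow> 'm vfield" where
  "curvature_field \<A> D X Y Z =
     (\<lambda>p f. cov D X (cov D Y Z) p f - cov D Y (cov D X Z) p f - cov D (bracket \<A> X Y) Z p f)"

definition torsion_tensor ::
  "('m::topological_space, 'd::finite) chart set \<Rightarrow> ('m \<Rightarrow> 'm tvec \<Rightarrow> 'm tvec \<Rightarrow> real) \<Rightarrow> 'm connection \<Rightarrow>
   'm \<Rightarrow> 'm tvec \<Rightarrow> 'm tvec \<Rightarrow> 'm tvec \<Rightarrow> real" where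
  "torsion_tensor \<A> g D p x y z = g p (torsion_field \<A> D (extend \<A> p x) (extend \<A> p y) p) z"

definition curvature_tensor ::
  "('m::topological_space, 'd::finite) chart set \<Rightarrow> ('m \<Rightarrow> 'm tvec \<Rightarrow> 'm tvec \<Rightarrow> real) \<Rightarrow> 'm connection \<Rightarrow>
   'm \<Rightarrow> 'm tvec \<Rightarrow> 'm tvec \<Rightarrow> 'm tvec \<Rightarrow> 'm tvec \<Rightarrow> real" where
  "curvature_tensor \<A> g D p x y z w =
     g p (curvature_field \<A> D (extend \<A> p x) (extend \<A> p y) (extend \<A> p z) p) w"

definition metric_connection ::
  "('m::topological_space, 'd::finite) chart set \<Rightarrow> ('m \<Rightarrow> 'm tvec \<Rightarrow> 'm tvec \<Rightarrow> real) \<Rightarrow> 'm connection \<Rightarrow> bool" where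
  "metric_connection \<A> g D \<longleftrightarrow>
     (\<forall>W Y Z p. open W \<and> p \<in> W \<and> vector_field \<A> W Y \<and> vector_field \<A> W Z \<longrightarrow>
        (\<forall>v\<in>tangent_space \<A> p.
           v (\<lambda>q. g q (Y q) (Z q)) = g p (D p v Y) (Z p) + g p (Y p) (D p v Z)))"

definition levi_civita ::
  "('m::topological_space, 'd::finite) chart set \<Rightarrow> ('m \<Rightarrow> 'm tvec \<Rightarrow> 'm tvec \<Rightarrow> real) \<Rightarrow> 'm connection \<Rightarrow> bool" where
  "levi_civita \<A> g D \<longleftrightarrow>
     linear_connection \<A> D \<and> metric_connection \<A> g D \<and>
     (\<forall>W X Y. open W \<and> vector_field \<A> W X \<and> vector_field \<A> W Y \<longrightarrow>
        (\<forall>p\<in>W. torsion_field \<A> D X Y p = (\<lambda>f. 0)))"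

text \<open>\<open>(\<nabla>\<^sub>v P) Y\<close> at \<open>p\<close>.\<close>

definition cov_endo ::
  "'m connection \<Rightarrow> ('m \<Rightarrow> 'm tvec \<Rightarrow> 'm tvec) \<Rightarrow> 'm \<Rightarrow> 'm tvec \<Rightarrow> 'm vfield \<Rightarrow> 'm tvec" where
  "cov_endo D P p v Y = (\<lambda>f. D p v (\<lambda>q. P q (Y q)) f - P p (D p v Y) f)"

definition natural_connection ::
  "('m::topological_space, 'd::finite) chart set \<Rightarrow> ('m \<Rightarrow> 'm tvec \<Rightarrow> 'm tvec) \<Rightarrow>
   ('m \<Rightarrow> 'm tvec \<Rightarrow> 'm tvec \<Rightarrow> real) \<Rightarrow> 'm connection \<Rightarrow> bool" where
  "natural_connection \<A> P g D \<longleftrightarrow>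
     linear_connection \<A> D \<and> metric_connection \<A> g D \<and>
     (\<forall>W Y p. open W \<and> p \<in> W \<and> vector_field \<A> W Y \<longrightarrow>
        (\<forall>v\<in>tangent_space \<A> p. cov_endo D P p v Y = (\<lambda>f. 0)))"

section \<open>The tensor F, its associated 1-form, and the two classes\<close>

text \<open>In this section \<open>D\<close> is meant to be the Levi-Civita connection of \<open>g\<close>, and \<open>n\<close> half the
  dimension.\<close>

definition F_tensor ::
  "('m::topological_space, 'd::finite) chart set \<Rightarrow> ('m \<Rightarrow> 'm tvec \<Rightarrow> 'm tvec) \<Rightarrow>
   ('m \<Rightarrow> 'm tvec \<Rightarrow> 'm tvec \<Rightarrow> real) \<Rightarrow> 'm connection \<Rightarrow>
   'm \<Rightarrow> 'm tvec \<Rightarrow> 'm tvec \<Rightarrow> 'm tvec \<Rightarrow> real" where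
  "F_tensor \<A> P g D p x y z = g p (cov_endo D P p x (extend \<A> p y)) z"

definition theta ::
  "('m::topological_space, 'd::finite) chart set \<Rightarrow> ('m \<Rightarrow> 'm tvec \<Rightarrow> 'm tvec) \<Rightarrow>
   ('m \<Rightarrow> 'm tvec \<Rightarrow> 'm tvec \<Rightarrow> real) \<Rightarrow> 'm connection \<Rightarrow> 'm \<Rightarrow> 'm tvec \<Rightarrow> real" where
  "theta \<A> P g D p x = metric_trace \<A> g p (\<lambda>u v. F_tensor \<A> P g D p u v x)"

definition closed_one_form ::
  "('m::topological_space, 'd::finite) chart set \<Rightarrow> ('m \<Rightarrow> 'm tvec \<Rightarrow> real) \<Rightarrow> bool" where
  "closed_one_form \<A> \<alpha> \<longleftrightarrow>
     (\<forall>W X Y. open W \<and> vector_field \<A> W X \<and> vector_field \<A> W Y \<longrightarrow>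
        (\<forall>p\<in>W. X p (\<lambda>q. \<alpha> q (Y q)) - Y p (\<lambda>q. \<alpha> q (X q)) - \<alpha> p (bracket \<A> X Y p) = 0))"

definition class_W3 ::
  "nat \<Rightarrow> ('m::topological_space, 'd::finite) chart set \<Rightarrow> ('m \<Rightarrow> 'm tvec \<Rightarrow> 'm tvec) \<Rightarrow>
   ('m \<Rightarrow> 'm tvec \<Rightarrow> 'm tvec \<Rightarrow> real) \<Rightarrow> 'm connection \<Rightarrow> bool" where
  "class_W3 n \<A> P g D \<longleftrightarrow> (let \<theta> = theta \<A> P g D in
     \<forall>p. \<forall>x\<in>tangent_space \<A> p.
       (\<forall>y\<in>tangent_space \<A> p. \<forall>z\<in>tangent_space \<A> p.
          F_tensor \<A> P g D p x y z = 1 / (2 * real n) *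
            ((g p x y + g p x (P p y)) * \<theta> p z + (g p x z + g p x (P p z)) * \<theta> p y)) \<and>
       \<theta> p (P p x) = - \<theta> p x)"

definition class_W6 ::
  "nat \<Rightarrow> ('m::topological_space, 'd::finite) chart set \<Rightarrow> ('m \<Rightarrow> 'm tvec \<Rightarrow> 'm tvec) \<Rightarrow>
   ('m \<Rightarrow> 'm tvec \<Rightarrow> 'm tvec \<Rightarrow> real) \<Rightarrow> 'm connection \<Rightarrow> bool" where
  "class_W6 n \<A> P g D \<longleftrightarrow> (let \<theta> = theta \<A> P g D in
     \<forall>p. \<forall>x\<in>tangent_space \<A> p.
       (\<forall>y\<in>tangent_space \<A> p. \<forall>z\<in>tangent_space \<A> p.
          F_tensor \<A> P g D p x y z = 1 / (2 * real n) *
            ((g p x y - g p x (P p y)) * \<theta> p z + (g p x z - g p x (P p z)) * \<theta> p y)) \<and>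
       \<theta> p (P p x) = \<theta> p x)"

text \<open>\<open>D'\<close> is the member with parameters \<open>l\<close>, \<open>m\<close> of the 2-parameter family of natural
  connections.\<close>

definition natural_family ::
  "nat \<Rightarrow> ('m::topological_space, 'd::finite) chart set \<Rightarrow> ('m \<Rightarrow> 'm tvec \<Rightarrow> 'm tvec) \<Rightarrow>
   ('m \<Rightarrow> 'm tvec \<Rightarrow> 'm tvec \<Rightarrow> real) \<Rightarrow> 'm connection \<Rightarrow> real \<Rightarrow> real \<Rightarrow> 'm connection \<Rightarrow> bool" where
  "natural_family n \<A> P g D l m D' \<longleftrightarrow>
     natural_connection \<A> P g D' \<and>
     (let \<theta> = theta \<A> P g D in
      \<forall>p. \<forall>x\<in>tangent_space \<A> p. \<forall>y\<in>tangent_space \<A> p. \<forall>z\<in>tangent_space \<A> p.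
        torsion_tensor \<A> g D' p x y z =
          1 / (2 * real n) * (g p y z * \<theta> p (P p x) - g p x z * \<theta> p (P p y))
          + l * (g p y z * \<theta> p x - g p x z * \<theta> p y
                 + g p y (P p z) * \<theta> p (P p x) - g p x (P p z) * \<theta> p (P p y))
          + m * (g p y (P p z) * \<theta> p x - g p x (P p z) * \<theta> p y
                 + g p y z * \<theta> p (P p x) - g p x z * \<theta> p (P p y)))"

definition canonical_connection ::
  "nat \<Rightarrow> ('m::topological_space, 'd::finite) chart set \<Rightarrow> ('m \<Rightarrow> 'm tvec \<Rightarrow> 'm tvec) \<Rightarrow>
   ('m \<Rightarrow> 'm tvec \<Rightarrow> 'm tvec \<Rightarrow> real) \<Rightarrow> 'm connection \<Rightarrow> 'm connection \<Rightarrow> bool" where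
  "canonical_connection n \<A> P g D D' \<longleftrightarrow> natural_family n \<A> P g D 0 (- 1 / (4 * real n)) D'"

section \<open>Algebraic operations on (0,4)-tensors at a point\<close>

type_synonym 'm tensor4 = "'m tvec \<Rightarrow> 'm tvec \<Rightarrow> 'm tvec \<Rightarrow> 'm tvec \<Rightarrow> real"

definition K_tensor ::
  "('m::topological_space, 'd::finite) chart set \<Rightarrow> ('m \<Rightarrow> 'm tvec \<Rightarrow> 'm tvec) \<Rightarrow>
   ('m \<Rightarrow> 'm tvec \<Rightarrow> 'm tvec \<Rightarrow> real) \<Rightarrow> 'm connection \<Rightarrow> 'm \<Rightarrow> 'm tensor4" where
  "K_tensor \<A> P g D p x y z w =
     1 / 2 * (curvature_tensor \<A> g D p x y z w + curvature_tensor \<A> g D p x y (P p z) (P p w))"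

definition ricci ::
  "('m::topological_space, 'd::finite) chart set \<Rightarrow> ('m \<Rightarrow> 'm tvec \<Rightarrow> 'm tvec \<Rightarrow> real) \<Rightarrow> 'm \<Rightarrow>
   'm tensor4 \<Rightarrow> 'm tvec \<Rightarrow> 'm tvec \<Rightarrow> real" where
  "ricci \<A> g p L y z = metric_trace \<A> g p (\<lambda>u v. L u y z v)"

definition scalar_curv ::
  "('m::topological_space, 'd::finite) chart set \<Rightarrow> ('m \<Rightarrow> 'm tvec \<Rightarrow> 'm tvec \<Rightarrow> real) \<Rightarrow> 'm \<Rightarrow>
   'm tensor4 \<Rightarrow> real" where
  "scalar_curv \<A> g p L = metric_trace \<A> g p (ricci \<A> g p L)"

definition psi1 :: "('m tvec \<Rightarrow> 'm tvec \<Rightarrow> real) \<Rightarrow> ('m tvec \<Rightarrow> 'm tvec \<Rightarrow> real) \<Rightarrow> 'm tensor4" where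
  "psi1 h S x y z w = h y z * S x w - h x z * S y w + S y z * h x w - S x z * h y w"

definition psi2 ::
  "('m tvec \<Rightarrow> 'm tvec) \<Rightarrow> ('m tvec \<Rightarrow> 'm tvec \<Rightarrow> real) \<Rightarrow> ('m tvec \<Rightarrow> 'm tvec \<Rightarrow> real) \<Rightarrow> 'm tensor4" where
  "psi2 Q h S x y z w = psi1 h S x y (Q z) (Q w)"

definition pi1 :: "('m tvec \<Rightarrow> 'm tvec \<Rightarrow> real) \<Rightarrow> 'm tensor4" where
  "pi1 h x y z w = 1 / 2 * psi1 h h x y z w"

definition pi2 :: "('m tvec \<Rightarrow> 'm tvec) \<Rightarrow> ('m tvec \<Rightarrow> 'm tvec \<Rightarrow> real) \<Rightarrow> 'm tensor4" where
  "pi2 Q h x y z w = 1 / 2 * psi2 Q h h x y z w"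

definition pi3 :: "('m tvec \<Rightarrow> 'm tvec) \<Rightarrow> ('m tvec \<Rightarrow> 'm tvec \<Rightarrow> real) \<Rightarrow> 'm tensor4" where
  "pi3 Q h = psi1 h (\<lambda>x y. h x (Q y))"

definition A_tensor ::
  "nat \<Rightarrow> ('m::topological_space, 'd::finite) chart set \<Rightarrow> ('m \<Rightarrow> 'm tvec \<Rightarrow> 'm tvec) \<Rightarrow>
   ('m \<Rightarrow> 'm tvec \<Rightarrow> 'm tvec \<Rightarrow> real) \<Rightarrow> real \<Rightarrow> 'm \<Rightarrow> 'm tensor4 \<Rightarrow> 'm tensor4" where
  "A_tensor n \<A> P g \<epsilon> p L x y z w =
     L x y z w - scalar_curv \<A> g p L *
       (pi1 (g p) x y z w + pi2 (P p) (g p) x y z w - \<epsilon> * pi3 (P p) (g p) x y z w)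
       / (4 * real n * (real n - 1))"

end

theory Submission
  imports Defs
begin

text \<open>
  Write \<open>h(x,y) = \<epsilon> g(x,y) - g(x,Py)\<close>, \<open>c = 1/(4n)\<close>, and let \<open>\<Omega>\<close> be the vector dual to \<open>\<theta>\<close>.
  For the canonical connection the torsion reduces to
  \<open>T(x,y,z) = c (h(y,z) \<theta>(x) - h(x,z) \<theta>(y))\<close>. A metric connection is determined by its torsion,
  hence \<open>D'\<close> differs from the Levi-Civita connection \<open>D\<close> by
  \<open>g(D'\<^sub>x Y - D\<^sub>x Y, z) = c (h(x,Y) \<theta>(z) - h(x,z) \<theta>(Y))\<close> (\<open>difference\<close>).

  The tangent bundle is the orthogonal sum of the eigenbundles of \<open>P\<close> for \<open>\<epsilon>\<close> and \<open>-\<epsilon>\<close>, and \<open>D'\<close>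
  preserves both. The form \<open>h\<close> vanishes as soon as one argument lies in the first, and \<open>\<theta>\<close> vanishes on
  the second. So for two sections \<open>Z\<close>, \<open>Z'\<close> of the same eigenbundle
  \<open>g(D'\<^sub>x Z, Z') = g(D\<^sub>x Z, Z')\<close>: on each eigenbundle \<open>D'\<close> is the orthogonal projection of \<open>D\<close>. The
  curvatures \<open>R'\<close> and \<open>R\<close> are then related by Gauss equations. On the \<open>\<epsilon>\<close>-eigenbundle the second
  fundamental form contributes a term symmetric in \<open>x\<close> and \<open>y\<close>, and \<open>R' = R\<close> (\<open>curvature_plus\<close>). On the
  \<open>-\<epsilon>\<close>-eigenbundle it contributes
  \<open>c\<^sup>2 \<theta>(\<Omega>) (h(y,z) h(x,w) - h(x,z) h(y,w))\<close> (\<open>curvature_minus\<close>). Both \<open>R'\<close> and \<open>K\<close> vanish when \<open>z\<close>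
  and \<open>w\<close> lie in different eigenspaces. Altogether \<open>R' = K + c\<^sup>2 \<theta>(\<Omega>) \<Pi>\<close> with
  \<open>\<Pi> = \<pi>\<^sub>1 + \<pi>\<^sub>2 - \<epsilon> \<pi>\<^sub>3\<close> (\<open>canonical_curvature\<close>, \<open>pi_combination\<close>). Since \<open>\<tau>(\<Pi>) = 4n(n-1)\<close>, the
  map \<open>A\<close> annihilates \<open>\<Pi>\<close>, and \<open>A(R') = A(K)\<close>.

  No derivative of \<open>\<theta>\<close> or \<open>h\<close> occurs, because \<open>R\<close> and \<open>R'\<close> are only compared on sections of one
  eigenbundle at a time. This requires replacing the extensions in the definition of the curvature
  tensor by eigensections. Tensoriality in the third argument follows from metric compatibility
  alone: the curvature is skew in the last two (\<open>curvature_skew\<close>, \<open>curvature_tensorial\<close>). The remaining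
  foundation is the existence of local extensions of tangent vectors (\<open>extend_obtain\<close>) and of bases
  of the tangent spaces (\<open>some_basis\<close>), which rest on a calculus of \<open>C\<^sup>k\<close> functions.
\<close>

section \<open>Calculus of functions of class \<open>C\<^sup>k\<close>\<close>

lemma C_k_on_subset: "C_k_on k S f \<Longrightarrow> T \<subseteq> S \<Longrightarrow> C_k_on k T f"
  by (induction k arbitrary: f) (auto intro: continuous_on_subset)

lemma frechet_derivative_cong_open:
  assumes "open S" "x \<in> S" "\<And>y. y \<in> S \<Longrightarrow> f y = g y"
  shows "frechet_derivative f (at x) = frechet_derivative g (at x)"
proof -
  have "(f has_derivative D) (at x) \<longleftrightarrow> (g has_derivative D) (at x)" for D
    using assms has_derivative_transform_within_open[of f D x UNIV S g]
      has_derivative_transform_within_open[of g D x UNIV S f] by auto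
  then show ?thesis
    by (simp add: frechet_derivative_def)
qed

lemma differentiable_cong_open:
  assumes "open S" "x \<in> S" "\<And>y. y \<in> S \<Longrightarrow> f y = g y" "f differentiable (at x)"
  shows "g differentiable (at x)"
  using assms has_derivative_transform_within_open[of f _ x UNIV S g]
  unfolding differentiable_def by metis

lemma C_k_on_cong:
  assumes "open S" "\<And>x. x \<in> S \<Longrightarrow> f x = g x" "C_k_on k S f"
  shows "C_k_on k S g"
  using assms(2,3)
proof (induction k arbitrary: f g)
  case 0
  then show ?case by (simp cong: continuous_on_cong)
next
  case (Suc k)
  have "C_k_on k S (\<lambda>x. frechet_derivative g (at x) b)" if "b \<in> Basis" for b
    using Suc.IH[of "\<lambda>x. frechet_derivative f (at x) b" "\<lambda>x. frechet_derivative g (at x) b"]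
      Suc.prems that frechet_derivative_cong_open[OF assms(1) _ Suc.prems(1)] by fastforce
  then show ?case
    using Suc.prems(2) differentiable_cong_open[OF assms(1) _ Suc.prems(1)] by auto
qed

lemma C_k_on_Suc_imp: "C_k_on (Suc k) S f \<Longrightarrow> C_k_on k S f"
proof (induction k arbitrary: f)
  case 0
  then show ?case
    by (auto intro!: continuous_at_imp_continuous_on differentiable_imp_continuous_within)
next
  case (Suc k)
  then show ?case by (metis C_k_on.simps(2))
qed

lemma C_k_on_const: "C_k_on k S (\<lambda>x. c)"
  by (induction k arbitrary: c) auto

lemma C_k_on_add:
  assumes "open S" "C_k_on k S f" "C_k_on k S g"
  shows "C_k_on k S (\<lambda>x. f x + g x)"
  using assms(2,3)
proof (induction k arbitrary: f g)
  case 0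
  then show ?case by (simp add: continuous_on_add)
next
  case (Suc k)
  have diff: "((\<lambda>x. f x + g x) has_derivative
      (\<lambda>h. frechet_derivative f (at x) h + frechet_derivative g (at x) h)) (at x)"
    if "x \<in> S" for x
    using Suc.prems that by (intro has_derivative_add) (auto simp: frechet_derivative_works)
  have "C_k_on k S (\<lambda>x. frechet_derivative (\<lambda>x. f x + g x) (at x) b)" if b: "b \<in> Basis" for b
  proof (rule C_k_on_cong[OF assms(1)])
    show "C_k_on k S (\<lambda>x. frechet_derivative f (at x) b + frechet_derivative g (at x) b)"
      using Suc b by auto
    show "frechet_derivative f (at x) b + frechet_derivative g (at x) b
        = frechet_derivative (\<lambda>x. f x + g x) (at x) b" if "x \<in> S" for x
      using frechet_derivative_at[OF diff[OF that]] by metis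
  qed
  then show ?case using diff by (auto simp: differentiable_def)
qed

lemma C_k_on_sum:
  assumes "open S" "\<And>i. i \<in> I \<Longrightarrow> C_k_on k S (f i)"
  shows "C_k_on k S (\<lambda>x. \<Sum>i\<in>I. f i x)"
  using assms(2)
  by (induction I rule: infinite_finite_induct) (auto intro: C_k_on_const C_k_on_add[OF assms(1)])

lemma C_k_on_scaleR:
  assumes "open S" "C_k_on k S f" "C_k_on k S g"
  shows "C_k_on k S (\<lambda>x. f x *\<^sub>R g x)"
  using assms(2,3)
proof (induction k arbitrary: f g)
  case 0
  then show ?case by (simp add: continuous_on_scaleR)
next
  case (Suc k)
  have diff: "((\<lambda>x. f x *\<^sub>R g x) has_derivative
      (\<lambda>h. f x *\<^sub>R frechet_derivative g (at x) h + frechet_derivative f (at x) h *\<^sub>R g x)) (at x)"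
    if "x \<in> S" for x
    using Suc.prems that by (intro has_derivative_scaleR) (auto simp: frechet_derivative_works)
  have "C_k_on k S (\<lambda>x. frechet_derivative (\<lambda>x. f x *\<^sub>R g x) (at x) b)" if b: "b \<in> Basis" for b
  proof (rule C_k_on_cong[OF assms(1)])
    show "C_k_on k S (\<lambda>x. f x *\<^sub>R frechet_derivative g (at x) b + frechet_derivative f (at x) b *\<^sub>R g x)"
      using Suc.prems b
      by (intro C_k_on_add[OF assms(1)] Suc.IH) (auto intro: C_k_on_Suc_imp simp del: C_k_on.simps(2) dest: C_k_on.simps(2)[THEN iffD1])
    show "f x *\<^sub>R frechet_derivative g (at x) b + frechet_derivative f (at x) b *\<^sub>R g x
        = frechet_derivative (\<lambda>x. f x *\<^sub>R g x) (at x) b" if "x \<in> S" for x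
      using frechet_derivative_at[OF diff[OF that]] by metis
  qed
  then show ?case using diff by (auto simp: differentiable_def)
qed

lemma C_k_on_inner_left:
  fixes f :: "'a::euclidean_space \<Rightarrow> 'b::euclidean_space"
  assumes "open S" "C_k_on k S f"
  shows "C_k_on k S (\<lambda>x. f x \<bullet> i)"
  using assms(2)
proof (induction k arbitrary: f)
  case 0
  then show ?case by (simp add: continuous_on_inner)
next
  case (Suc k)
  have diff: "((\<lambda>x. f x \<bullet> i) has_derivative (\<lambda>h. frechet_derivative f (at x) h \<bullet> i)) (at x)"
    if "x \<in> S" for x
    using Suc.prems that by (intro has_derivative_inner_left) (auto simp: frechet_derivative_works)
  have "C_k_on k S (\<lambda>x. frechet_derivative (\<lambda>x. f x \<bullet> i) (at x) b)" if b: "b \<in> Basis" for b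
  proof (rule C_k_on_cong[OF assms(1)])
    show "C_k_on k S (\<lambda>x. frechet_derivative f (at x) b \<bullet> i)"
      using Suc b by auto
    show "frechet_derivative f (at x) b \<bullet> i = frechet_derivative (\<lambda>x. f x \<bullet> i) (at x) b" if "x \<in> S" for x
      using frechet_derivative_at[OF diff[OF that]] by metis
  qed
  then show ?case using diff by (auto simp: differentiable_def)
qed

lemma frechet_derivative_Basis_expand:
  fixes f :: "'a::euclidean_space \<Rightarrow> 'b::real_normed_vector"
  assumes "f differentiable (at x)"
  shows "frechet_derivative f (at x) a = (\<Sum>i\<in>Basis. (a \<bullet> i) *\<^sub>R frechet_derivative f (at x) i)"
proof -
  interpret linear "frechet_derivative f (at x)"
    using assms by (rule linear_frechet_derivative)
  have "frechet_derivative f (at x) a = frechet_derivative f (at x) (\<Sum>i\<in>Basis. (a \<bullet> i) *\<^sub>R i)"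
    by (simp add: euclidean_representation)
  also have "\<dots> = (\<Sum>i\<in>Basis. (a \<bullet> i) *\<^sub>R frechet_derivative f (at x) i)"
    by (simp add: sum scaleR)
  finally show ?thesis .
qed

lemma C_k_on_directional:
  fixes f :: "'a::euclidean_space \<Rightarrow> 'b::real_normed_vector"
  assumes "open S" "C_k_on (Suc k) S f"
  shows "C_k_on k S (\<lambda>x. frechet_derivative f (at x) a)"
proof (rule C_k_on_cong[OF assms(1)])
  show "C_k_on k S (\<lambda>x. \<Sum>i\<in>Basis. (a \<bullet> i) *\<^sub>R frechet_derivative f (at x) i)"
    using assms by (intro C_k_on_sum C_k_on_scaleR C_k_on_const) auto
  show "(\<Sum>i\<in>Basis. (a \<bullet> i) *\<^sub>R frechet_derivative f (at x) i) = frechet_derivative f (at x) a"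
    if "x \<in> S" for x
    using assms(2) that by (simp add: frechet_derivative_Basis_expand[of f x a])
qed

lemma C_k_on_compose:
  fixes f :: "'b::euclidean_space \<Rightarrow> 'c::real_normed_vector"
    and u :: "'a::euclidean_space \<Rightarrow> 'b"
  assumes "open S" "u ` S \<subseteq> T" "C_k_on k T f" "C_k_on k S u"
  shows "C_k_on k S (f \<circ> u)"
  using assms(3,4)
proof (induction k arbitrary: f)
  case 0
  then show ?case using assms(2) by (metis C_k_on.simps(1) continuous_on_compose continuous_on_subset)
next
  case (Suc k)
  have diff: "((f \<circ> u) has_derivative
      (frechet_derivative f (at (u x)) \<circ> frechet_derivative u (at x))) (at x)"
    if "x \<in> S" for x
    using Suc.prems that assms(2)
    by (intro diff_chain_at) (auto simp: frechet_derivative_works[symmetric])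
  have "C_k_on k S (\<lambda>x. frechet_derivative (f \<circ> u) (at x) b)" if b: "b \<in> Basis" for b
  proof (rule C_k_on_cong[OF assms(1)])
    show "C_k_on k S (\<lambda>x. \<Sum>i\<in>Basis. (frechet_derivative u (at x) b \<bullet> i) *\<^sub>R
        ((\<lambda>y. frechet_derivative f (at y) i) \<circ> u) x)"
      using Suc.prems b C_k_on_Suc_imp[OF Suc.prems(2)]
      by (intro C_k_on_sum[OF assms(1)] C_k_on_scaleR[OF assms(1)] C_k_on_inner_left[OF assms(1)]
          Suc.IH) auto
    show "(\<Sum>i\<in>Basis. (frechet_derivative u (at x) b \<bullet> i) *\<^sub>R
        ((\<lambda>y. frechet_derivative f (at y) i) \<circ> u) x) = frechet_derivative (f \<circ> u) (at x) b"
      if "x \<in> S" for x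
    proof -
      have "f differentiable (at (u x))" using Suc.prems that assms(2) by auto
      then show ?thesis
        unfolding frechet_derivative_at[OF diff[OF that], symmetric] comp_apply
        by (rule frechet_derivative_Basis_expand[symmetric])
    qed
  qed
  then show ?case
    unfolding C_k_on.simps differentiable_def using diff by blast
qed

section \<open>Smooth functions and tangent vectors on a manifold\<close>

lemma smooth_fun_subset:
  assumes "smooth_fun \<A> W f" "V \<subseteq> W"
  shows "smooth_fun \<A> V f"
proof -
  have "C_k_on k (\<phi> ` (U \<inter> V)) (f \<circ> inv_into U \<phi>)" if "(U, \<phi>) \<in> \<A>" for U \<phi> k
  proof (rule C_k_on_subset)
    show "C_k_on k (\<phi> ` (U \<inter> W)) (f \<circ> inv_into U \<phi>)"
      using assms(1) that unfolding smooth_fun_def smooth_on_def by blast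
  qed (use assms(2) in blast)
  then show ?thesis unfolding smooth_fun_def smooth_on_def by blast
qed

lemma vector_field_subset:
  assumes "vector_field \<A> W X" "V \<subseteq> W"
  shows "vector_field \<A> V X"
  unfolding vector_field_def
proof (intro conjI allI impI ballI)
  show "X p \<in> tangent_space \<A> p" if "p \<in> V" for p
    using assms that unfolding vector_field_def by auto
  show "smooth_fun \<A> V' (\<lambda>p. X p f)" if "open V' \<and> V' \<subseteq> V \<and> smooth_fun \<A> V' f" for V' f
  proof -
    have "V' \<subseteq> W" using that assms(2) by blast
    then show ?thesis using assms(1) that unfolding vector_field_def by simp
  qed
qed

lemma vector_field_tangent: "vector_field \<A> W X \<Longrightarrow> p \<in> W \<Longrightarrow> X p \<in> tangent_space \<A> p"
  unfolding vector_field_def by blast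

text \<open>Fixing the atlas gives the tangent spaces the short name \<open>T p\<close>.\<close>

locale smooth_manifold =
  fixes \<A> :: "('m::{t2_space, second_countable_topology}, 'd::finite) chart set"
  assumes atlas: "smooth_atlas \<A>"
begin

abbreviation "T \<equiv> tangent_space \<A>"

lemma chart_exists: "\<exists>U \<phi>. (U, \<phi>) \<in> \<A> \<and> p \<in> U"
proof -
  have "p \<in> (\<Union>(U, \<phi>)\<in>\<A>. U)"
    using atlas unfolding smooth_atlas_def by simp
  then show ?thesis by blast
qed

lemma chart_open: "(U, \<phi>) \<in> \<A> \<Longrightarrow> open U"
  and chart_homeomorphism: "(U, \<phi>) \<in> \<A> \<Longrightarrow> homeomorphism U (\<phi> ` U) \<phi> (inv_into U \<phi>)"
  using atlas unfolding smooth_atlas_def by blast+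

lemma chart_inv [simp]: "(U, \<phi>) \<in> \<A> \<Longrightarrow> q \<in> U \<Longrightarrow> inv_into U \<phi> (\<phi> q) = q"
  by (rule homeomorphism_apply1[OF chart_homeomorphism])

lemma chart_image_open:
  assumes "(U, \<phi>) \<in> \<A>" "open W"
  shows "open (\<phi> ` (U \<inter> W))"
proof -
  have "openin (top_of_set (\<phi> ` U)) (\<phi> ` (U \<inter> W))"
    using homeomorphism_imp_open_map[OF chart_homeomorphism[OF assms(1)]] assms(2)
    by (simp add: openin_open_Int)
  moreover have "open (\<phi> ` U)"
    using atlas assms(1) unfolding smooth_atlas_def by blast
  ultimately show ?thesis
    using openin_open_trans by blast
qed

lemma transition_smooth:
  assumes "(U, \<phi>) \<in> \<A>" "(V, \<psi>) \<in> \<A>"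
  shows "smooth_on (\<phi> ` (U \<inter> V)) (\<psi> \<circ> inv_into U \<phi>)"
  using atlas assms unfolding smooth_atlas_def by blast

lemma smooth_fun_cong:
  assumes "open W" "\<And>q. q \<in> W \<Longrightarrow> f q = f' q" "smooth_fun \<A> W f"
  shows "smooth_fun \<A> W f'"
proof -
  have "C_k_on k (\<phi> ` (U \<inter> W)) (f' \<circ> inv_into U \<phi>)" if c: "(U, \<phi>) \<in> \<A>" for U \<phi> k
  proof (rule C_k_on_cong[OF chart_image_open[OF c assms(1)]])
    show "C_k_on k (\<phi> ` (U \<inter> W)) (f \<circ> inv_into U \<phi>)"
      using assms(3) c unfolding smooth_fun_def smooth_on_def by auto
  qed (use assms(2) c in auto)
  then show ?thesis unfolding smooth_fun_def smooth_on_def by auto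
qed

lemma smooth_near_cong_imp:
  assumes "open W" "p \<in> W" "\<And>q. q \<in> W \<Longrightarrow> f q = f' q" "smooth_near \<A> p f"
  shows "smooth_near \<A> p f'"
proof -
  obtain V where V: "open V" "p \<in> V" "smooth_fun \<A> V f"
    using assms(4) unfolding smooth_near_def by blast
  have "smooth_fun \<A> (V \<inter> W) f'"
  proof (rule smooth_fun_cong[where f = f])
    show "smooth_fun \<A> (V \<inter> W) f"
      by (rule smooth_fun_subset[OF V(3)]) simp
    show "open (V \<inter> W)" using V assms(1) by (simp add: open_Int)
    show "f q = f' q" if "q \<in> V \<inter> W" for q
      by (rule assms(3)) (use that in simp)
  qed
  then show ?thesis
    unfolding smooth_near_def using assms(1,2) V(1,2) by (intro exI[of _ "V \<inter> W"]) (simp add: open_Int)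
qed

lemma smooth_near_cong:
  assumes "open W" "p \<in> W" "\<And>q. q \<in> W \<Longrightarrow> f q = f' q"
  shows "smooth_near \<A> p f \<longleftrightarrow> smooth_near \<A> p f'"
proof
  show "smooth_near \<A> p f \<Longrightarrow> smooth_near \<A> p f'"
    by (rule smooth_near_cong_imp[where f = f, OF assms])
  show "smooth_near \<A> p f' \<Longrightarrow> smooth_near \<A> p f"
    by (rule smooth_near_cong_imp[where f = f', OF assms(1,2) assms(3)[symmetric]])
qed

lemma smooth_fun_const: "smooth_fun \<A> W (\<lambda>q. c)"
  unfolding smooth_fun_def smooth_on_def by (auto simp: comp_def C_k_on_const)

lemma smooth_fun_add:
  assumes "open W" "smooth_fun \<A> W f" "smooth_fun \<A> W f'"
  shows "smooth_fun \<A> W (\<lambda>q. f q + f' q)"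
  using assms chart_image_open
  unfolding smooth_fun_def smooth_on_def by (auto simp: comp_def intro!: C_k_on_add)

lemma smooth_fun_mult:
  assumes "open W" "smooth_fun \<A> W f" "smooth_fun \<A> W f'"
  shows "smooth_fun \<A> W (\<lambda>q. f q * f' q)"
  using assms chart_image_open
  unfolding smooth_fun_def smooth_on_def
  by (auto simp: comp_def intro!: C_k_on_scaleR[where 'b = real, unfolded real_scaleR_def])

lemma smooth_fun_coordinate:
  assumes "(U, \<phi>) \<in> \<A>"
  shows "smooth_fun \<A> U (\<lambda>q. \<phi> q $ i)"
proof -
  have "C_k_on k (\<psi> ` (V \<inter> U)) (\<lambda>x. (\<phi> \<circ> inv_into V \<psi>) x \<bullet> axis i 1)"
    if "(V, \<psi>) \<in> \<A>" for V \<psi> k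
    using transition_smooth[OF that assms] chart_image_open[OF that chart_open[OF assms]]
    unfolding smooth_on_def by (intro C_k_on_inner_left) blast+
  then show ?thesis
    unfolding smooth_fun_def smooth_on_def by (auto simp: comp_def inner_axis)
qed

lemma smooth_near_differentiable:
  assumes "(U, \<phi>) \<in> \<A>" "p \<in> U" "smooth_near \<A> p f"
  shows "(f \<circ> inv_into U \<phi>) differentiable (at (\<phi> p))"
proof -
  obtain W where "open W" "p \<in> W" "smooth_fun \<A> W f"
    using assms(3) unfolding smooth_near_def by blast
  then have "C_k_on (Suc 0) (\<phi> ` (U \<inter> W)) (f \<circ> inv_into U \<phi>)"
    using assms(1) unfolding smooth_fun_def smooth_on_def by blast
  then show ?thesis using \<open>p \<in> W\<close> assms(2) by simp
qed

text \<open>A tangent vector may be given in any chart around its base point. Consequently \<open>T p\<close> is the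
  linear image of the coordinate space under a single chart, which makes it a vector space.\<close>

lemma coord_tangent_change_chart:
  assumes c: "(U, \<phi>) \<in> \<A>" "p \<in> U" and c': "(V, \<psi>) \<in> \<A>" "p \<in> V"
  shows "coord_tangent \<A> (U, \<phi>) p a
    = coord_tangent \<A> (V, \<psi>) p (frechet_derivative (\<psi> \<circ> inv_into U \<phi>) (at (\<phi> p)) a)"
proof
  fix f
  let ?\<tau> = "\<psi> \<circ> inv_into U \<phi>"
  have "frechet_derivative (f \<circ> inv_into U \<phi>) (at (\<phi> p)) a
      = frechet_derivative (f \<circ> inv_into V \<psi>) (at (\<psi> p)) (frechet_derivative ?\<tau> (at (\<phi> p)) a)"
    if sm: "smooth_near \<A> p f"
  proof -
    have "C_k_on (Suc 0) (\<phi> ` (U \<inter> V)) ?\<tau>"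
      using transition_smooth[OF c(1) c'(1)] unfolding smooth_on_def by blast
    then have d\<tau>: "(?\<tau> has_derivative frechet_derivative ?\<tau> (at (\<phi> p))) (at (\<phi> p))"
      using c c' by (auto simp: frechet_derivative_works[symmetric])
    have df: "((f \<circ> inv_into V \<psi>) has_derivative frechet_derivative (f \<circ> inv_into V \<psi>) (at (\<psi> p)))
        (at (?\<tau> (\<phi> p)))"
      using smooth_near_differentiable[OF c' sm] c by (simp add: frechet_derivative_works[symmetric])
    have "frechet_derivative (f \<circ> inv_into U \<phi>) (at (\<phi> p))
        = frechet_derivative ((f \<circ> inv_into V \<psi>) \<circ> ?\<tau>) (at (\<phi> p))"
      by (rule frechet_derivative_cong_open[OF chart_image_open[OF c(1) chart_open[OF c'(1)]]])
        (use c c' in auto)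
    then show ?thesis
      using frechet_derivative_at[OF diff_chain_at[OF d\<tau> df]] by (metis comp_apply)
  qed
  then show "coord_tangent \<A> (U, \<phi>) p a f
    = coord_tangent \<A> (V, \<psi>) p (frechet_derivative ?\<tau> (at (\<phi> p)) a) f"
    by (simp add: coord_tangent_def)
qed

lemma tangent_iff_chart:
  assumes "(U, \<phi>) \<in> \<A>" "p \<in> U"
  shows "v \<in> T p \<longleftrightarrow> (\<exists>a. v = coord_tangent \<A> (U, \<phi>) p a)"
proof
  assume "v \<in> T p"
  then obtain V \<psi> a where "(V, \<psi>) \<in> \<A>" "p \<in> V" "v = coord_tangent \<A> (V, \<psi>) p a"
    unfolding tangent_space_def by auto
  then show "\<exists>a. v = coord_tangent \<A> (U, \<phi>) p a"
    using coord_tangent_change_chart assms by metis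
next
  show "\<exists>a. v = coord_tangent \<A> (U, \<phi>) p a \<Longrightarrow> v \<in> T p"
    using assms unfolding tangent_space_def by (metis (mono_tags, lifting) fst_conv mem_Collect_eq)
qed

lemma coord_tangent_linear:
  assumes "(U, \<phi>) \<in> \<A>" "p \<in> U"
  shows "coord_tangent \<A> (U, \<phi>) p (r *\<^sub>R a + s *\<^sub>R b)
    = (\<lambda>f. r * coord_tangent \<A> (U, \<phi>) p a f + s * coord_tangent \<A> (U, \<phi>) p b f)"
proof
  fix f
  show "coord_tangent \<A> (U, \<phi>) p (r *\<^sub>R a + s *\<^sub>R b) f
    = r * coord_tangent \<A> (U, \<phi>) p a f + s * coord_tangent \<A> (U, \<phi>) p b f"
  proof (cases "smooth_near \<A> p f")
    case True
    interpret linear "frechet_derivative (f \<circ> inv_into U \<phi>) (at (\<phi> p))"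
      by (rule linear_frechet_derivative[OF smooth_near_differentiable[OF assms True]])
    show ?thesis using True by (simp add: coord_tangent_def add scaleR)
  qed (simp add: coord_tangent_def)
qed

lemma tangent_lincomb:
  assumes "u \<in> T p" "v \<in> T p"
  shows "(\<lambda>f. r * u f + s * v f) \<in> T p"
proof -
  obtain U \<phi> where c: "(U, \<phi>) \<in> \<A>" "p \<in> U" using chart_exists by blast
  then obtain a b where "u = coord_tangent \<A> (U, \<phi>) p a" "v = coord_tangent \<A> (U, \<phi>) p b"
    using assms tangent_iff_chart by blast
  then show ?thesis
    using coord_tangent_linear[OF c, symmetric] tangent_iff_chart[OF c] by auto
qed

lemma tangent_scale: "u \<in> T p \<Longrightarrow> (\<lambda>f. r * u f) \<in> T p"
  using tangent_lincomb[of u p u r 0] by simp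

lemma tangent_diff: "u \<in> T p \<Longrightarrow> v \<in> T p \<Longrightarrow> (\<lambda>f. u f - v f) \<in> T p"
  using tangent_lincomb[of u p v 1 "-1"] by simp

lemma tangent_zero: "(\<lambda>f. 0) \<in> T p"
proof -
  obtain U \<phi> where c: "(U, \<phi>) \<in> \<A>" "p \<in> U" using chart_exists by blast
  show ?thesis using tangent_scale[of "coord_tangent \<A> (U, \<phi>) p 0" p 0] tangent_iff_chart[OF c] by auto
qed

lemma tangent_sum:
  assumes "\<And>i. i \<in> I \<Longrightarrow> e i \<in> T p"
  shows "(\<lambda>f. \<Sum>i\<in>I. c i * e i f) \<in> T p"
  using assms
proof (induction I rule: infinite_finite_induct)
  case (insert i I)
  then show ?case
    using tangent_lincomb[of "e i" p "\<lambda>f. \<Sum>i\<in>I. c i * e i f" "c i" 1] by simp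
qed (auto simp: tangent_zero)

lemma tangent_cong:
  assumes "v \<in> T p" "open W" "p \<in> W" "\<And>q. q \<in> W \<Longrightarrow> f q = f' q"
  shows "v f = v f'"
proof -
  obtain U \<phi> where c: "(U, \<phi>) \<in> \<A>" "p \<in> U" using chart_exists by blast
  obtain a where v: "v = coord_tangent \<A> (U, \<phi>) p a"
    using assms(1) tangent_iff_chart[OF c] by blast
  have "frechet_derivative (f \<circ> inv_into U \<phi>) (at (\<phi> p)) = frechet_derivative (f' \<circ> inv_into U \<phi>) (at (\<phi> p))"
    by (rule frechet_derivative_cong_open[OF chart_image_open[OF c(1) assms(2)]]) (use c assms in auto)
  then show ?thesis
    using smooth_near_cong[OF assms(2-4)] by (simp add: v coord_tangent_def)
qed

lemma tangent_const:
  assumes "v \<in> T p"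
  shows "v (\<lambda>q. c) = 0"
proof -
  obtain U \<phi> a where "v = coord_tangent \<A> (U, \<phi>) p a"
    using assms unfolding tangent_space_def by auto
  then show ?thesis
    using frechet_derivative_at[OF has_derivative_const[of c "at (\<phi> p)"], symmetric]
    by (simp add: coord_tangent_def comp_def)
qed

lemma tangent_add:
  assumes "v \<in> T p" "open W" "p \<in> W" "smooth_fun \<A> W f" "smooth_fun \<A> W f'"
  shows "v (\<lambda>q. f q + f' q) = v f + v f'"
proof -
  obtain U \<phi> where c: "(U, \<phi>) \<in> \<A>" "p \<in> U" using chart_exists by blast
  obtain a where v: "v = coord_tangent \<A> (U, \<phi>) p a"
    using assms(1) tangent_iff_chart[OF c] by blast
  have sm: "smooth_near \<A> p f" "smooth_near \<A> p f'" "smooth_near \<A> p (\<lambda>q. f q + f' q)"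
    using assms smooth_fun_add unfolding smooth_near_def by blast+
  have "((f \<circ> inv_into U \<phi>) has_derivative frechet_derivative (f \<circ> inv_into U \<phi>) (at (\<phi> p))) (at (\<phi> p))"
    "((f' \<circ> inv_into U \<phi>) has_derivative frechet_derivative (f' \<circ> inv_into U \<phi>) (at (\<phi> p))) (at (\<phi> p))"
    using smooth_near_differentiable[OF c] sm by (auto simp: frechet_derivative_works[symmetric])
  from frechet_derivative_at[OF has_derivative_add[OF this], symmetric]
  have "frechet_derivative ((\<lambda>q. f q + f' q) \<circ> inv_into U \<phi>) (at (\<phi> p)) a =
      frechet_derivative (f \<circ> inv_into U \<phi>) (at (\<phi> p)) a +
      frechet_derivative (f' \<circ> inv_into U \<phi>) (at (\<phi> p)) a"
    unfolding comp_def by (rule fun_cong)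
  then show ?thesis
    using sm by (simp add: v coord_tangent_def)
qed

section \<open>Smooth vector fields\<close>

lemma vector_field_lincomb:
  assumes "open W" "vector_field \<A> W X" "vector_field \<A> W Y"
  shows "vector_field \<A> W (\<lambda>q f. r * X q f + s * Y q f)"
  unfolding vector_field_def
proof (intro conjI allI impI ballI)
  show "(\<lambda>f. r * X p f + s * Y p f) \<in> T p" if "p \<in> W" for p
    by (intro tangent_lincomb vector_field_tangent[OF assms(2) that] vector_field_tangent[OF assms(3) that])
  show "smooth_fun \<A> V (\<lambda>p. r * X p f + s * Y p f)" if "open V \<and> V \<subseteq> W \<and> smooth_fun \<A> V f" for V f
  proof -
    have "smooth_fun \<A> V (\<lambda>p. X p f)" "smooth_fun \<A> V (\<lambda>p. Y p f)"
      using assms that unfolding vector_field_def by simp_all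
    then show ?thesis
      using that by (intro smooth_fun_add smooth_fun_mult smooth_fun_const) simp_all
  qed
qed

text \<open>Constant coefficients in a chart give a smooth field on the domain of that chart. Smoothness
  read in the other charts is where closure under composition is needed.\<close>

lemma coord_vector_field:
  assumes c: "(U, \<phi>) \<in> \<A>"
  shows "vector_field \<A> U (\<lambda>q. coord_tangent \<A> (U, \<phi>) q a)"
  unfolding vector_field_def
proof (intro conjI allI impI ballI)
  show "coord_tangent \<A> (U, \<phi>) q a \<in> T q" if "q \<in> U" for q
    using c that tangent_iff_chart by blast
next
  fix V f
  assume "open V \<and> V \<subseteq> U \<and> smooth_fun \<A> V f"
  then have V: "open V" "V \<subseteq> U" and f: "smooth_fun \<A> V f" by auto
  have "C_k_on k (\<psi> ` (U' \<inter> V)) ((\<lambda>q. coord_tangent \<A> (U, \<phi>) q a f) \<circ> inv_into U' \<psi>)"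
    if c': "(U', \<psi>) \<in> \<A>" for U' \<psi> k
  proof (rule C_k_on_cong[OF chart_image_open[OF c' V(1)]])
    let ?df = "\<lambda>x. frechet_derivative (f \<circ> inv_into U \<phi>) (at x) a"
    show "C_k_on k (\<psi> ` (U' \<inter> V)) (?df \<circ> (\<phi> \<circ> inv_into U' \<psi>))"
    proof (rule C_k_on_compose)
      show "(\<phi> \<circ> inv_into U' \<psi>) ` \<psi> ` (U' \<inter> V) \<subseteq> \<phi> ` (U \<inter> V)"
        using c' V by auto
      show "C_k_on k (\<phi> ` (U \<inter> V)) ?df"
        using f c unfolding smooth_fun_def smooth_on_def
        by (intro C_k_on_directional chart_image_open[OF c V(1)]) blast
      show "C_k_on k (\<psi> ` (U' \<inter> V)) (\<phi> \<circ> inv_into U' \<psi>)"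
        using transition_smooth[OF c' c] V unfolding smooth_on_def
        by (blast intro: C_k_on_subset)
    qed (rule chart_image_open[OF c' V(1)])
    fix x
    assume "x \<in> \<psi> ` (U' \<inter> V)"
    then obtain q where q: "q \<in> U'" "q \<in> V" "x = \<psi> q" by auto
    moreover have "smooth_near \<A> q f"
      using q V f unfolding smooth_near_def by blast
    ultimately show "(?df \<circ> (\<phi> \<circ> inv_into U' \<psi>)) x
        = ((\<lambda>q. coord_tangent \<A> (U, \<phi>) q a f) \<circ> inv_into U' \<psi>) x"
      using c' by (simp add: coord_tangent_def)
  qed
  then show "smooth_fun \<A> V (\<lambda>q. coord_tangent \<A> (U, \<phi>) q a f)"
    unfolding smooth_fun_def smooth_on_def by auto
qed

lemma extend_obtain:
  assumes "v \<in> T p"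
  obtains W where "open W" "p \<in> W" "vector_field \<A> W (extend \<A> p v)" "extend \<A> p v p = v"
proof -
  obtain U \<phi> where c: "(U, \<phi>) \<in> \<A>" "p \<in> U" using chart_exists by blast
  obtain a where v: "v = coord_tangent \<A> (U, \<phi>) p a"
    using assms(1) tangent_iff_chart[OF c] by blast
  have "\<exists>X W. open W \<and> p \<in> W \<and> vector_field \<A> W X \<and> X p = v"
    by (rule exI[of _ "\<lambda>q. coord_tangent \<A> (U, \<phi>) q a"], rule exI[of _ U])
      (simp add: v c(2) chart_open[OF c(1)] coord_vector_field[OF c(1)])
  then have "\<exists>W. open W \<and> p \<in> W \<and> vector_field \<A> W (extend \<A> p v) \<and> extend \<A> p v p = v"
    unfolding extend_def by (rule someI_ex)
  then show ?thesis by (elim exE conjE) (rule that)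
qed

lemma coord_tangent_expand:
  assumes c: "(U, \<phi>) \<in> \<A>" "p \<in> U"
  shows "coord_tangent \<A> (U, \<phi>) p a = (\<lambda>f. \<Sum>i\<in>UNIV. a $ i * coord_tangent \<A> (U, \<phi>) p (axis i 1) f)"
proof
  fix f
  show "coord_tangent \<A> (U, \<phi>) p a f = (\<Sum>i\<in>UNIV. a $ i * coord_tangent \<A> (U, \<phi>) p (axis i 1) f)"
  proof (cases "smooth_near \<A> p f")
    case True
    interpret linear "frechet_derivative (f \<circ> inv_into U \<phi>) (at (\<phi> p))"
      by (rule linear_frechet_derivative[OF smooth_near_differentiable[OF c True]])
    have "a = (\<Sum>i\<in>UNIV. a $ i *\<^sub>R axis i 1)"
      by (simp add: basis_expansion flip: scalar_mult_eq_scaleR)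
    then have "frechet_derivative (f \<circ> inv_into U \<phi>) (at (\<phi> p)) a
        = frechet_derivative (f \<circ> inv_into U \<phi>) (at (\<phi> p)) (\<Sum>i\<in>UNIV. a $ i *\<^sub>R axis i 1)"
      by (rule arg_cong)
    also have "\<dots> = (\<Sum>i\<in>UNIV. a $ i * frechet_derivative (f \<circ> inv_into U \<phi>) (at (\<phi> p)) (axis i 1))"
      by (simp add: sum scaleR)
    finally have "frechet_derivative (f \<circ> inv_into U \<phi>) (at (\<phi> p)) a
        = (\<Sum>i\<in>UNIV. a $ i * frechet_derivative (f \<circ> inv_into U \<phi>) (at (\<phi> p)) (axis i 1))" .
    then show ?thesis using True by (simp add: coord_tangent_def)
  qed (simp add: coord_tangent_def)
qed

lemma coord_tangent_coordinate:
  assumes c: "(U, \<phi>) \<in> \<A>" "p \<in> U"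
  shows "coord_tangent \<A> (U, \<phi>) p a (\<lambda>q. \<phi> q $ i) = a $ i"
proof -
  have "smooth_near \<A> p (\<lambda>q. \<phi> q $ i)"
    using smooth_fun_coordinate[OF c(1)] chart_open[OF c(1)] c(2) unfolding smooth_near_def by blast
  moreover have "frechet_derivative ((\<lambda>q. \<phi> q $ i) \<circ> inv_into U \<phi>) (at (\<phi> p))
      = frechet_derivative (\<lambda>x. x $ i) (at (\<phi> p))"
    by (rule frechet_derivative_cong_open[OF chart_image_open[OF c(1) open_UNIV]]) (use c in auto)
  moreover have "frechet_derivative (\<lambda>x. x $ i) (at (\<phi> p)) = (\<lambda>x. x $ i)"
    by (rule frechet_derivative_at[symmetric, OF bounded_linear_imp_has_derivative[OF bounded_linear_vec_nth]])
  ultimately show ?thesis by (simp add: coord_tangent_def)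
qed

text \<open>The coordinate vectors of a chart form a basis. Uniqueness of the coefficients comes from
  applying a vector to the coordinate functions.\<close>

lemma some_basis: "tangent_basis \<A> p (some_basis \<A> p)"
proof -
  obtain U \<phi> where c: "(U, \<phi>) \<in> \<A>" "p \<in> U" using chart_exists by blast
  let ?e = "\<lambda>i. coord_tangent \<A> (U, \<phi>) p (axis i 1)"
  have "\<exists>!a::real ^ 'd. v = (\<lambda>f. \<Sum>i\<in>UNIV. a $ i * ?e i f)" if v: "v \<in> T p" for v
  proof -
    obtain a where v: "v = coord_tangent \<A> (U, \<phi>) p a"
      using v tangent_iff_chart[OF c] by blast
    have "\<exists>!a. v = coord_tangent \<A> (U, \<phi>) p a"
    proof (rule ex1I)
      fix b
      assume b: "v = coord_tangent \<A> (U, \<phi>) p b"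
      have "b $ i = a $ i" for i
        using coord_tangent_coordinate[OF c, of a i] coord_tangent_coordinate[OF c, of b i]
        unfolding b[symmetric] v[symmetric] by simp
      then show "b = a" by (simp add: vec_eq_iff)
    qed (rule v)
    then show ?thesis
      by (simp only: coord_tangent_expand[OF c, symmetric])
  qed
  moreover have "?e i \<in> T p" for i
    unfolding tangent_iff_chart[OF c] by (rule exI) (rule refl)
  ultimately have "tangent_basis \<A> p ?e"
    unfolding tangent_basis_def by (intro conjI allI ballI)
  then show ?thesis
    unfolding some_basis_def by (rule someI[where P = "tangent_basis \<A> p"])
qed

section \<open>Linear connections\<close>

lemma connection_tangent:
  assumes "linear_connection \<A> D" "open W" "p \<in> W" "vector_field \<A> W Y" "v \<in> T p"
  shows "D p v Y \<in> T p"
proof -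
  obtain V where V: "open V" "p \<in> V" "vector_field \<A> V (extend \<A> p v)" "extend \<A> p v p = v"
    using extend_obtain[OF assms(5)] .
  have "open (W \<inter> V)" "vector_field \<A> (W \<inter> V) (extend \<A> p v)" "vector_field \<A> (W \<inter> V) Y"
    using V assms vector_field_subset by (simp_all add: open_Int vector_field_subset)
  then have "vector_field \<A> (W \<inter> V) (cov D (extend \<A> p v) Y)"
    using assms(1) unfolding linear_connection_def by simp
  then have "cov D (extend \<A> p v) Y p \<in> T p"
    by (rule vector_field_tangent) (simp add: assms V)
  then show ?thesis by (simp add: cov_def V)
qed

lemma connection_field:
  assumes "linear_connection \<A> D" "open W" "vector_field \<A> W X" "vector_field \<A> W Y"
  shows "vector_field \<A> W (cov D X Y)"
  using assms unfolding linear_connection_def by simp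

lemma connection_cong:
  assumes "linear_connection \<A> D" "open W" "p \<in> W" "vector_field \<A> W Y" "vector_field \<A> W Z"
    and "\<And>q. q \<in> W \<Longrightarrow> Y q = Z q" and "v \<in> T p"
  shows "D p v Y = D p v Z"
proof -
  have "\<forall>W Y Z p. open W \<and> p \<in> W \<and> vector_field \<A> W Y \<and> vector_field \<A> W Z \<and> (\<forall>q\<in>W. Y q = Z q) \<longrightarrow>
        (\<forall>v\<in>T p. D p v Y = D p v Z)"
    using assms(1) unfolding linear_connection_def by (elim conjE)
  from this[rule_format, of W p Y Z v] show ?thesis using assms by simp
qed

lemma connection_scale:
  assumes "linear_connection \<A> D" "open W" "p \<in> W" "vector_field \<A> W Y" "v \<in> T p"
  shows "D p v (\<lambda>q f. s * Y q f) = (\<lambda>f. s * D p v Y f)"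
proof -
  have "\<forall>W Y h p. open W \<and> p \<in> W \<and> vector_field \<A> W Y \<and> smooth_fun \<A> W h \<longrightarrow>
        (\<forall>v\<in>T p. D p v (\<lambda>q f. h q * Y q f) = (\<lambda>f. v h * Y p f + h p * D p v Y f))"
    using assms(1) unfolding linear_connection_def by (elim conjE)
  from this[rule_format, of W p Y "\<lambda>q. s" v] show ?thesis
    using assms by (simp add: smooth_fun_const tangent_const)
qed

text \<open>Brackets of fields are only ever formed in the presence of a torsion-free connection. This
  formula then shows that they are tangent vectors, with no recourse to the symmetry of second
  derivatives.\<close>

lemma torsion_free_bracket:
  assumes "torsion_field \<A> D X Y p = (\<lambda>f. 0)"
  shows "bracket \<A> X Y p = (\<lambda>f. D p (X p) Y f - D p (Y p) X f)"
proof
  fix f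
  show "bracket \<A> X Y p f = D p (X p) Y f - D p (Y p) X f"
    using fun_cong[OF assms, of f] by (simp add: torsion_field_def cov_def)
qed

end

section \<open>Almost product metrics and their traces\<close>

locale almost_product_manifold =
  fixes \<A> :: "('m::{t2_space, second_countable_topology}, 'd::finite) chart set"
    and P :: "'m \<Rightarrow> 'm tvec \<Rightarrow> 'm tvec"
    and g :: "'m \<Rightarrow> 'm tvec \<Rightarrow> 'm tvec \<Rightarrow> real"
  assumes almost_product: "riemannian_almost_product \<A> P g"
begin

sublocale smooth_manifold \<A>
  by unfold_locales (use almost_product in \<open>simp add: riemannian_almost_product_def\<close>)

lemma metric: "riemannian_metric \<A> g"
  and endo: "endomorphism_field \<A> P"
  using almost_product by (simp_all add: riemannian_almost_product_def)

lemma g_lincomb_left: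
  "u \<in> T p \<Longrightarrow> v \<in> T p \<Longrightarrow> w \<in> T p \<Longrightarrow>
    g p (\<lambda>f. a * u f + b * v f) w = a * g p u w + b * g p v w"
  using metric unfolding riemannian_metric_def by simp

lemma g_sym: "u \<in> T p \<Longrightarrow> v \<in> T p \<Longrightarrow> g p u v = g p v u"
  using metric unfolding riemannian_metric_def by simp

lemma g_pos: "u \<in> T p \<Longrightarrow> u \<noteq> (\<lambda>f. 0) \<Longrightarrow> g p u u > 0"
  using metric unfolding riemannian_metric_def by simp

lemma g_smooth:
  "open W \<Longrightarrow> vector_field \<A> W X \<Longrightarrow> vector_field \<A> W Y \<Longrightarrow> smooth_fun \<A> W (\<lambda>p. g p (X p) (Y p))"
  using metric unfolding riemannian_metric_def by simp

lemma g_lincomb_right: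
  "u \<in> T p \<Longrightarrow> v \<in> T p \<Longrightarrow> w \<in> T p \<Longrightarrow>
    g p w (\<lambda>f. a * u f + b * v f) = a * g p w u + b * g p w v"
  by (simp add: g_sym[of w] tangent_lincomb g_lincomb_left)

lemma g_diff_left:
  "u \<in> T p \<Longrightarrow> v \<in> T p \<Longrightarrow> w \<in> T p \<Longrightarrow> g p (\<lambda>f. u f - v f) w = g p u w - g p v w"
  using g_lincomb_left[of u p v w 1 "-1"] by simp

lemma g_scale_left: "u \<in> T p \<Longrightarrow> w \<in> T p \<Longrightarrow> g p (\<lambda>f. a * u f) w = a * g p u w"
  using g_lincomb_left[of u p u w a 0] by simp

lemma g_scale_right: "u \<in> T p \<Longrightarrow> w \<in> T p \<Longrightarrow> g p w (\<lambda>f. a * u f) = a * g p w u"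
  using g_lincomb_right[of u p u w a 0] by simp

lemma g_sum_right:
  assumes "w \<in> T p" "\<And>i. i \<in> I \<Longrightarrow> e i \<in> T p"
  shows "g p w (\<lambda>f. \<Sum>i\<in>I. c i * e i f) = (\<Sum>i\<in>I. c i * g p w (e i))"
  using assms(2)
proof (induction I rule: infinite_finite_induct)
  case (insert i I)
  then show ?case
    using g_lincomb_right[of "e i" p "\<lambda>f. \<Sum>i\<in>I. c i * e i f" w "c i" 1] assms(1)
    by (simp add: tangent_sum)
qed (use g_scale_right[OF tangent_zero assms(1), of 0] in auto)

lemma P_tangent [intro, simp]: "u \<in> T p \<Longrightarrow> P p u \<in> T p"
  using endo unfolding endomorphism_field_def by simp

lemma P_lincomb:
  "u \<in> T p \<Longrightarrow> v \<in> T p \<Longrightarrow> P p (\<lambda>f. a * u f + b * v f) = (\<lambda>f. a * P p u f + b * P p v f)"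
  using endo unfolding endomorphism_field_def by simp

lemma P_field: "open W \<Longrightarrow> vector_field \<A> W X \<Longrightarrow> vector_field \<A> W (\<lambda>p. P p (X p))"
  using endo unfolding endomorphism_field_def by simp

lemma P_P [simp]: "u \<in> T p \<Longrightarrow> P p (P p u) = u"
  and g_P_P: "u \<in> T p \<Longrightarrow> v \<in> T p \<Longrightarrow> g p (P p u) (P p v) = g p u v"
  using almost_product by (simp_all add: riemannian_almost_product_def)

lemma g_P_sym: "u \<in> T p \<Longrightarrow> v \<in> T p \<Longrightarrow> g p (P p u) v = g p u (P p v)"
  using g_P_P[of u p "P p v"] by simp

abbreviation "e \<equiv> some_basis \<A>"

lemma basis_tangent [simp]: "e p i \<in> T p"
  using some_basis unfolding tangent_basis_def by blast

lemma basis_coefficients: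
  assumes "v \<in> T p"
  shows "\<exists>!c::real ^ 'd. v = (\<lambda>f. \<Sum>i\<in>UNIV. c $ i * e p i f)"
  using some_basis[of p] assms unfolding tangent_basis_def by simp

text \<open>The matrix of \<open>g\<close> at \<open>p\<close> in the basis that the traces are taken in. Its inverse has the
  entries \<open>g\<^sup>i\<^sup>j\<close>.\<close>

definition gram :: "'m \<Rightarrow> real ^ 'd ^ 'd" where
  "gram p = (\<chi> i j. g p (e p i) (e p j))"

lemma gram_inverse: "(\<Sum>i\<in>UNIV. matrix_inv (gram p) $ i $ j * gram p $ i $ k) = (if j = k then 1 else 0)"
proof -
  have "c = 0" if c: "gram p *v c = 0" for c
  proof -
    let ?u = "\<lambda>f. \<Sum>i\<in>UNIV. c $ i * e p i f"
    have u: "?u \<in> T p" by (simp add: tangent_sum)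
    have "g p (e p i) ?u = 0" for i
      using c by (simp add: g_sum_right vec_eq_iff matrix_vector_mult_def gram_def mult.commute)
    then have "g p ?u ?u = 0"
      using g_sum_right[OF u, of UNIV "e p" "\<lambda>i. c $ i"] by (simp add: g_sym[OF u])
    then have "?u = (\<lambda>f. 0)" using g_pos[OF u] by fastforce
    moreover have "(\<lambda>f. 0) = (\<lambda>f. \<Sum>i\<in>UNIV. (0::real^'d) $ i * e p i f)" by simp
    ultimately show "c = 0"
      using basis_coefficients[OF tangent_zero, of p] by metis
  qed
  then have "invertible (gram p)"
    using matrix_left_invertible_ker[of "gram p"] invertible_left_inverse by blast
  then have "gram p ** matrix_inv (gram p) = mat 1 \<and> matrix_inv (gram p) ** gram p = mat 1"
    unfolding invertible_def matrix_inv_def by (rule someI_ex)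
  then have "(gram p ** matrix_inv (gram p)) $ k $ j = mat 1 $ k $ j"
    by simp
  moreover have "gram p $ i $ k = gram p $ k $ i" for i
    by (simp add: gram_def g_sym)
  ultimately show ?thesis
    by (simp add: matrix_matrix_mult_def mat_def mult.commute)
qed

lemma metric_trace_gram:
  "metric_trace \<A> g p B = (\<Sum>i\<in>UNIV. \<Sum>j\<in>UNIV. matrix_inv (gram p) $ i $ j * B (e p i) (e p j))"
  by (simp add: metric_trace_def gram_def Let_def)

lemma metric_trace_cong:
  assumes "\<And>u v. u \<in> T p \<Longrightarrow> v \<in> T p \<Longrightarrow> B u v = B' u v"
  shows "metric_trace \<A> g p B = metric_trace \<A> g p B'"
  by (simp add: metric_trace_gram assms)

lemma metric_trace_lincomb:
  "metric_trace \<A> g p (\<lambda>u v. a * B u v + b * B' u v)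
    = a * metric_trace \<A> g p B + b * metric_trace \<A> g p B'"
  by (simp add: metric_trace_gram algebra_simps sum.distrib sum_distrib_left)

text \<open>Contracting \<open>g(u, Q v)\<close> gives the trace of \<open>Q\<close>. The traces of \<open>g\<close>, of \<open>P\<close> and of
  products of two linear forms are instances.\<close>

lemma metric_trace_endo:
  assumes "\<And>j. Q (e p j) = (\<lambda>f. \<Sum>k\<in>UNIV. (c j :: real ^ 'd) $ k * e p k f)"
  shows "metric_trace \<A> g p (\<lambda>u v. g p u (Q v)) = (\<Sum>j\<in>UNIV. c j $ j)"
proof -
  have "metric_trace \<A> g p (\<lambda>u v. g p u (Q v))
      = (\<Sum>i\<in>UNIV. \<Sum>j\<in>UNIV. \<Sum>k\<in>UNIV. c j $ k * (matrix_inv (gram p) $ i $ j * gram p $ i $ k))"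
    by (simp add: metric_trace_gram assms g_sum_right gram_def sum_distrib_left sum_distrib_right ac_simps)
  also have "\<dots> = (\<Sum>j\<in>UNIV. \<Sum>i\<in>UNIV. \<Sum>k\<in>UNIV. c j $ k * (matrix_inv (gram p) $ i $ j * gram p $ i $ k))"
    by (rule sum.swap)
  also have "\<dots> = (\<Sum>j\<in>UNIV. \<Sum>k\<in>UNIV. \<Sum>i\<in>UNIV. c j $ k * (matrix_inv (gram p) $ i $ j * gram p $ i $ k))"
    by (rule sum.cong[OF refl]) (rule sum.swap)
  also have "\<dots> = (\<Sum>j\<in>UNIV. \<Sum>k\<in>UNIV. c j $ k * (if j = k then 1 else 0))"
    by (simp only: sum_distrib_left[symmetric] gram_inverse)
  also have "\<dots> = (\<Sum>j\<in>UNIV. c j $ j)"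
    by (simp add: if_distrib cong: if_cong)
  finally show ?thesis .
qed

lemma metric_trace_metric: "metric_trace \<A> g p (g p) = real CARD('d)"
proof -
  have "e p j = (\<lambda>f. \<Sum>k\<in>UNIV. (axis j 1 :: real ^ 'd) $ k * e p k f)" for j
    by (simp add: axis_def if_distrib if_distribR cong: if_cong)
  from metric_trace_endo[where Q = "\<lambda>v. v", OF this] show ?thesis
    by (simp add: axis_def)
qed

lemma metric_trace_P: "metric_trace \<A> g p (\<lambda>u v. g p u (P p v)) = endo_trace \<A> p (P p)"
  unfolding endo_trace_def Let_def
  by (rule metric_trace_endo) (rule theI'[OF basis_coefficients], simp)

lemma metric_trace_product:
  assumes "a \<in> T p" "b \<in> T p"
  shows "metric_trace \<A> g p (\<lambda>u v. g p u a * g p v b) = g p a b"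
proof -
  obtain c :: "real ^ 'd" where c: "a = (\<lambda>f. \<Sum>i\<in>UNIV. c $ i * e p i f)"
    using basis_coefficients[OF assms(1)] by blast
  have "metric_trace \<A> g p (\<lambda>u v. g p u a * g p v b)
      = metric_trace \<A> g p (\<lambda>u v. g p u (\<lambda>f. g p v b * a f))"
    by (rule metric_trace_cong) (simp add: g_scale_right assms)
  also have "\<dots> = (\<Sum>j\<in>UNIV. (g p (e p j) b *\<^sub>R c) $ j)"
    by (rule metric_trace_endo) (simp add: c sum_distrib_left ac_simps)
  also have "\<dots> = (\<Sum>j\<in>UNIV. c $ j * g p b (e p j))"
    by (simp add: g_sym[OF assms(2)] ac_simps)
  also have "\<dots> = g p a b"
    using g_sum_right[OF assms(2), of UNIV "e p" "\<lambda>i. c $ i"] g_sym[OF assms] by (simp add: c)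
  finally show ?thesis .
qed

lemma riesz_representation:
  fixes \<alpha> :: "'m tvec \<Rightarrow> real"
  assumes lin: "\<And>u v a b. u \<in> T p \<Longrightarrow> v \<in> T p \<Longrightarrow> \<alpha> (\<lambda>f. a * u f + b * v f) = a * \<alpha> u + b * \<alpha> v"
  obtains \<Omega> where "\<Omega> \<in> T p" "\<forall>u\<in>T p. g p \<Omega> u = \<alpha> u"
proof -
  have \<alpha>_sum: "\<alpha> (\<lambda>f. \<Sum>i\<in>I. c i * e p i f) = (\<Sum>i\<in>I. c i * \<alpha> (e p i))" for c and I :: "'d set"
  proof (induction I rule: infinite_finite_induct)
    case (insert i I)
    then show ?case
      using lin[of "e p i" "\<lambda>f. \<Sum>i\<in>I. c i * e p i f" "c i" 1] by (simp add: tangent_sum)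
  qed (use lin[OF tangent_zero tangent_zero, of 0 0] in auto)
  define I where "I = matrix_inv (gram p)"
  define \<Omega> where "\<Omega> = (\<lambda>f. \<Sum>i\<in>UNIV. (\<Sum>j\<in>UNIV. I $ i $ j * \<alpha> (e p j)) * e p i f)"
  have \<Omega>: "\<Omega> \<in> T p" unfolding \<Omega>_def by (simp add: tangent_sum)
  have e: "g p \<Omega> (e p k) = \<alpha> (e p k)" for k
  proof -
    have "g p \<Omega> (e p k) = g p (e p k) \<Omega>" by (simp add: g_sym \<Omega>)
    also have "\<dots> = (\<Sum>i\<in>UNIV. (\<Sum>j\<in>UNIV. I $ i $ j * \<alpha> (e p j)) * g p (e p k) (e p i))"
      unfolding \<Omega>_def by (rule g_sum_right) simp_all
    also have "\<dots> = (\<Sum>i\<in>UNIV. \<Sum>j\<in>UNIV. \<alpha> (e p j) * (I $ i $ j * gram p $ i $ k))"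
      by (simp add: gram_def sum_distrib_left sum_distrib_right ac_simps g_sym[of "e p k"])
    also have "\<dots> = (\<Sum>j\<in>UNIV. \<Sum>i\<in>UNIV. \<alpha> (e p j) * (I $ i $ j * gram p $ i $ k))"
      by (rule sum.swap)
    also have "\<dots> = (\<Sum>j\<in>UNIV. \<alpha> (e p j) * (if j = k then 1 else 0))"
      by (simp only: sum_distrib_left[symmetric] gram_inverse I_def)
    finally show ?thesis by (simp add: if_distrib cong: if_cong)
  qed
  have "g p \<Omega> u = \<alpha> u" if "u \<in> T p" for u
  proof -
    from basis_coefficients[OF that] obtain c :: "real ^ 'd"
      where c: "u = (\<lambda>f. \<Sum>i\<in>UNIV. c $ i * e p i f)" by blast
    show ?thesis unfolding c by (simp add: g_sum_right[OF \<Omega>] \<alpha>_sum e)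
  qed
  then show ?thesis using that \<Omega> by blast
qed

section \<open>Tensoriality from metric compatibility\<close>

lemma metric_connectionD:
  assumes "metric_connection \<A> g D" "open W" "p \<in> W" "vector_field \<A> W Y" "vector_field \<A> W Z" "v \<in> T p"
  shows "v (\<lambda>q. g q (Y q) (Z q)) = g p (D p v Y) (Z p) + g p (Y p) (D p v Z)"
  using assms unfolding metric_connection_def by simp

text \<open>For two metric connections, \<open>g((D'\<^sub>v - D\<^sub>v)Y, Z)\<close> is skew in \<open>Y\<close> and \<open>Z\<close>. Exchanging the
  two arguments shows that it depends on \<open>Y\<close> only through \<open>Y p\<close>.\<close>

lemma metric_difference_skew:
  assumes D: "linear_connection \<A> D" "metric_connection \<A> g D"
    and D': "linear_connection \<A> D'" "metric_connection \<A> g D'"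
    and W: "open W" "p \<in> W" and Y: "vector_field \<A> W Y" and Z: "vector_field \<A> W Z" and v: "v \<in> T p"
  shows "g p (D' p v Y) (Z p) - g p (D p v Y) (Z p) = - (g p (D' p v Z) (Y p) - g p (D p v Z) (Y p))"
proof -
  have "g p (Y p) (D p v Z) = g p (D p v Z) (Y p)" "g p (Y p) (D' p v Z) = g p (D' p v Z) (Y p)"
    by (intro g_sym vector_field_tangent[OF Y W(2)] connection_tangent[OF D(1) W Z v]
        connection_tangent[OF D'(1) W Z v])+
  then show ?thesis
    using metric_connectionD[OF D(2) W Y Z v] metric_connectionD[OF D'(2) W Y Z v] by simp
qed

lemma metric_difference_tensorial:
  assumes D: "linear_connection \<A> D" "metric_connection \<A> g D"
    and D': "linear_connection \<A> D'" "metric_connection \<A> g D'"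
    and Y: "open U" "p \<in> U" "vector_field \<A> U Y" and Y': "open V" "p \<in> V" "vector_field \<A> V Y'"
    and eq: "Y p = Y' p" and v: "v \<in> T p" and z: "z \<in> T p"
  shows "g p (D' p v Y) z - g p (D p v Y) z = g p (D' p v Y') z - g p (D p v Y') z"
proof -
  obtain N where N: "open N" "p \<in> N" "vector_field \<A> N (extend \<A> p z)" "extend \<A> p z p = z"
    using extend_obtain[OF z] .
  have W: "open (N \<inter> U \<inter> V)" "p \<in> N \<inter> U \<inter> V" using N Y Y' by (simp_all add: open_Int)
  have f: "vector_field \<A> (N \<inter> U \<inter> V) (extend \<A> p z)"
    "vector_field \<A> (N \<inter> U \<inter> V) Y" "vector_field \<A> (N \<inter> U \<inter> V) Y'"
    by (rule vector_field_subset[OF N(3)] vector_field_subset[OF Y(3)] vector_field_subset[OF Y'(3)]; blast)+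
  show ?thesis
    using metric_difference_skew[OF D D' W f(2) f(1) v] metric_difference_skew[OF D D' W f(3) f(1) v]
    by (simp add: N(4) eq)
qed

lemma curvature_field_tangent:
  assumes "linear_connection \<A> D" "open W" "p \<in> W"
    and "vector_field \<A> W X" "vector_field \<A> W Y" "vector_field \<A> W Z" "bracket \<A> X Y p \<in> T p"
  shows "curvature_field \<A> D X Y Z p \<in> T p"
  unfolding curvature_field_def
  by (intro tangent_diff) (auto simp: cov_def assms vector_field_tangent[OF _ assms(3)]
    intro!: connection_tangent[OF assms(1-3)] connection_field[OF assms(1,2), unfolded cov_def])

text \<open>Metric compatibility replaces the second covariant derivatives of \<open>Z\<close> by derivatives of
  functions and inner products of first covariant derivatives.\<close>

lemma curvature_pairing:
  assumes D: "linear_connection \<A> D" "metric_connection \<A> g D" and W: "open W" "p \<in> W"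
    and X: "vector_field \<A> W X" and Y: "vector_field \<A> W Y"
    and Z: "vector_field \<A> W Z" and Z': "vector_field \<A> W Z'" and br: "bracket \<A> X Y p \<in> T p"
  shows "g p (curvature_field \<A> D X Y Z p) (Z' p) =
     (X p (\<lambda>q. g q (D q (Y q) Z) (Z' q)) - g p (D p (Y p) Z) (D p (X p) Z'))
     - (Y p (\<lambda>q. g q (D q (X q) Z) (Z' q)) - g p (D p (X p) Z) (D p (Y p) Z'))
     - g p (D p (bracket \<A> X Y p) Z) (Z' p)"
proof -
  have x: "X p \<in> T p" "Y p \<in> T p" "Z' p \<in> T p"
    using vector_field_tangent[OF _ W(2)] X Y Z' by auto
  have f: "vector_field \<A> W (cov D Y Z)" "vector_field \<A> W (cov D X Z)"
    by (intro connection_field D W X Y Z)+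
  have t: "D p (X p) (cov D Y Z) \<in> T p" "D p (Y p) (cov D X Z) \<in> T p" "D p (bracket \<A> X Y p) Z \<in> T p"
    by (intro connection_tangent[OF D(1) W] f x br Z)+
  have "g p (curvature_field \<A> D X Y Z p) (Z' p)
     = g p (D p (X p) (cov D Y Z)) (Z' p) - g p (D p (Y p) (cov D X Z)) (Z' p)
       - g p (D p (bracket \<A> X Y p) Z) (Z' p)"
    using t x tangent_diff[OF t(1,2)] by (simp add: curvature_field_def cov_def[of _ _ "cov _ _ _"]
        cov_def[of _ "bracket _ _ _"] g_diff_left)
  then show ?thesis
    using metric_connectionD[OF D(2) W f(1) Z' x(1)] metric_connectionD[OF D(2) W f(2) Z' x(2)]
    by (simp add: cov_def)
qed

text \<open>The skewness of \<open>g(R(X,Y)Z, Z')\<close> is the statement that \<open>XY - YX - [X,Y]\<close> annihilates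
  \<open>g(Z, Z')\<close>. As for the difference of connections, skewness yields tensoriality in \<open>Z\<close>.\<close>

lemma curvature_skew:
  assumes D: "linear_connection \<A> D" "metric_connection \<A> g D" and W: "open W" "p \<in> W"
    and X: "vector_field \<A> W X" and Y: "vector_field \<A> W Y"
    and Z: "vector_field \<A> W Z" and Z': "vector_field \<A> W Z'" and br: "bracket \<A> X Y p \<in> T p"
  shows "g p (curvature_field \<A> D X Y Z p) (Z' p) = - g p (curvature_field \<A> D X Y Z' p) (Z p)"
proof -
  have x: "X p \<in> T p" "Y p \<in> T p" "Z p \<in> T p" "Z' p \<in> T p"
    using vector_field_tangent[OF _ W(2)] X Y Z Z' by auto
  have second: "u (\<lambda>q. V q (\<lambda>q. g q (Z q) (Z' q)))
      = u (\<lambda>q. g q (D q (V q) Z) (Z' q)) + u (\<lambda>q. g q (D q (V q) Z') (Z q))"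
    if u: "u \<in> T p" and V: "vector_field \<A> W V" for u V
  proof -
    have "u (\<lambda>q. V q (\<lambda>q. g q (Z q) (Z' q)))
        = u (\<lambda>q. g q (D q (V q) Z) (Z' q) + g q (D q (V q) Z') (Z q))"
    proof (rule tangent_cong[OF u W])
      fix q assume q: "q \<in> W"
      show "V q (\<lambda>q. g q (Z q) (Z' q)) = g q (D q (V q) Z) (Z' q) + g q (D q (V q) Z') (Z q)"
        using metric_connectionD[OF D(2) W(1) q Z Z' vector_field_tangent[OF V q]]
          g_sym[OF vector_field_tangent[OF Z q] connection_tangent[OF D(1) W(1) q Z' vector_field_tangent[OF V q]]]
        by simp
    qed
    also have "\<dots> = u (\<lambda>q. g q (D q (V q) Z) (Z' q)) + u (\<lambda>q. g q (D q (V q) Z') (Z q))"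
      using g_smooth[OF W(1) connection_field[OF D(1) W(1) V Z] Z']
        g_smooth[OF W(1) connection_field[OF D(1) W(1) V Z'] Z]
      by (intro tangent_add[OF u W]) (simp_all add: cov_def)
    finally show ?thesis .
  qed
  have "smooth_near \<A> p (\<lambda>q. g q (Z q) (Z' q))"
    unfolding smooth_near_def using W g_smooth[OF W(1) Z Z'] by blast
  then have "bracket \<A> X Y p (\<lambda>q. g q (Z q) (Z' q))
      = X p (\<lambda>q. Y q (\<lambda>q. g q (Z q) (Z' q))) - Y p (\<lambda>q. X q (\<lambda>q. g q (Z q) (Z' q)))"
    by (simp add: bracket_def)
  moreover have "bracket \<A> X Y p (\<lambda>q. g q (Z q) (Z' q))
      = g p (D p (bracket \<A> X Y p) Z) (Z' p) + g p (D p (bracket \<A> X Y p) Z') (Z p)"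
    using metric_connectionD[OF D(2) W Z Z' br] g_sym[OF x(3) connection_tangent[OF D(1) W Z' br]] by simp
  moreover have "g p (D p (X p) Z') (D p (Y p) Z) = g p (D p (Y p) Z) (D p (X p) Z')"
    "g p (D p (Y p) Z') (D p (X p) Z) = g p (D p (X p) Z) (D p (Y p) Z')"
    by (intro g_sym connection_tangent[OF D(1) W] Z Z' x)+
  ultimately show ?thesis
    using second[OF x(1) Y] second[OF x(2) X]
    by (simp add: curvature_pairing[OF D W X Y Z Z' br] curvature_pairing[OF D W X Y Z' Z br])
qed

lemma curvature_tensorial:
  assumes D: "linear_connection \<A> D" "metric_connection \<A> g D" and W: "open W" "p \<in> W"
    and X: "vector_field \<A> W X" and Y: "vector_field \<A> W Y"
    and Z: "vector_field \<A> W Z" and br: "bracket \<A> X Y p \<in> T p"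
    and V: "open V" "p \<in> V" "vector_field \<A> V Z'" and eq: "Z p = Z' p" and w: "w \<in> T p"
  shows "g p (curvature_field \<A> D X Y Z p) w = g p (curvature_field \<A> D X Y Z' p) w"
proof -
  obtain N where N: "open N" "p \<in> N" "vector_field \<A> N (extend \<A> p w)" "extend \<A> p w p = w"
    using extend_obtain[OF w] .
  have S: "open (N \<inter> W \<inter> V)" "p \<in> N \<inter> W \<inter> V" using N W V by (simp_all add: open_Int)
  have f: "vector_field \<A> (N \<inter> W \<inter> V) (extend \<A> p w)" "vector_field \<A> (N \<inter> W \<inter> V) X"
    "vector_field \<A> (N \<inter> W \<inter> V) Y" "vector_field \<A> (N \<inter> W \<inter> V) Z" "vector_field \<A> (N \<inter> W \<inter> V) Z'"
    by (rule vector_field_subset[OF N(3)] vector_field_subset[OF X] vector_field_subset[OF Y]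
        vector_field_subset[OF Z] vector_field_subset[OF V(3)]; blast)+
  show ?thesis
    using curvature_skew[OF D S f(2,3,4,1) br] curvature_skew[OF D S f(2,3,5,1) br]
    by (simp add: N(4) eq)
qed

section \<open>Eigenvectors of the almost product structure\<close>

lemma common_domain:
  assumes "x \<in> T p" "y \<in> T p"
  obtains W where "open W" "p \<in> W" "vector_field \<A> W (extend \<A> p x)" "vector_field \<A> W (extend \<A> p y)"
    "extend \<A> p x p = x" "extend \<A> p y p = y"
proof -
  obtain U where U: "open U" "p \<in> U" "vector_field \<A> U (extend \<A> p x)" "extend \<A> p x p = x"
    using extend_obtain[OF assms(1)] .
  obtain V where V: "open V" "p \<in> V" "vector_field \<A> V (extend \<A> p y)" "extend \<A> p y p = y"
    using extend_obtain[OF assms(2)] .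
  show ?thesis
    by (rule that[of "U \<inter> V"]) (use U V in \<open>auto simp: open_Int intro: vector_field_subset\<close>)
qed

text \<open>Applying the projection \<open>(1 + s P)/2\<close> to any extension of an eigenvector keeps its value at
  \<open>p\<close> and makes it a section of the eigenbundle.\<close>

lemma eigen_extension:
  assumes z: "z \<in> T p" and s: "s * s = 1" and Pz: "P p z = (\<lambda>f. s * z f)"
  obtains W Z where "open W" "p \<in> W" "vector_field \<A> W Z" "Z p = z"
    "\<forall>q\<in>W. P q (Z q) = (\<lambda>f. s * Z q f)"
proof -
  obtain W where W: "open W" "p \<in> W" "vector_field \<A> W (extend \<A> p z)" "extend \<A> p z p = z"
    using extend_obtain[OF z] .
  define X where "X = extend \<A> p z"
  define Z where "Z = (\<lambda>q f. (1/2) * X q f + (s/2) * P q (X q) f)"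
  have ss: "s * (s * r) = r" for r using s by (simp flip: mult.assoc)
  have 1: "vector_field \<A> W Z"
    unfolding Z_def X_def by (intro vector_field_lincomb P_field W)
  have 2: "Z p = z"
    by (simp add: Z_def X_def W(4) Pz ss)
  have 3: "P q (Z q) = (\<lambda>f. s * Z q f)" if "q \<in> W" for q
  proof -
    have "X q \<in> T q" unfolding X_def by (rule vector_field_tangent[OF W(3) that])
    then have "P q (Z q) = (\<lambda>f. (1/2) * P q (X q) f + (s/2) * X q f)"
      unfolding Z_def by (simp only: P_lincomb P_tangent P_P)
    then show ?thesis by (simp add: Z_def algebra_simps ss)
  qed
  show ?thesis by (rule that[OF W(1,2) 1 2]) (simp add: 3)
qed

lemma g_eigen_orthogonal:
  assumes "u \<in> T p" "v \<in> T p" "s * s = 1" "P p u = (\<lambda>f. s * u f)" "P p v = (\<lambda>f. - s * v f)"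
  shows "g p u v = 0"
proof -
  have "g p u v = g p (\<lambda>f. s * u f) (\<lambda>f. - s * v f)"
    using g_P_P[OF assms(1,2)] assms(4,5) by simp
  also have "\<dots> = - (s * s) * g p u v"
    using g_scale_left[OF assms(1) tangent_scale[OF assms(2)], of s "- s"] g_scale_right[OF assms(2,1), of "- s"]
    by simp
  finally show ?thesis using assms(3) by simp
qed

lemma eigenvector_diff:
  assumes "u \<in> T p" "v \<in> T p" "P p u = (\<lambda>f. s * u f)" "P p v = (\<lambda>f. s * v f)"
  shows "P p (\<lambda>f. u f - v f) = (\<lambda>f. s * (u f - v f))"
  using P_lincomb[OF assms(1,2), of 1 "-1"] assms(3,4) by (simp add: algebra_simps)

end

section \<open>The canonical connection\<close>

text \<open>The sign \<open>\<epsilon>\<close> is the one with \<open>\<theta>(Px) = \<epsilon> \<theta>(x)\<close>. Together with metric compatibility, the torsion of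
  the canonical connection then determines its difference from the Levi-Civita connection.\<close>

locale canonical_setting = almost_product_manifold \<A> P g
  for \<A> :: "('m::{t2_space, second_countable_topology}, 'd::finite) chart set"
    and P :: "'m \<Rightarrow> 'm tvec \<Rightarrow> 'm tvec"
    and g :: "'m \<Rightarrow> 'm tvec \<Rightarrow> 'm tvec \<Rightarrow> real" +
  fixes D D' :: "'m connection" and n :: nat and \<epsilon> :: real
  assumes levi_civita: "levi_civita \<A> g D"
    and canonical: "canonical_connection n \<A> P g D D'"
    and sign: "\<epsilon> * \<epsilon> = 1"
    and theta_P: "\<And>p x. x \<in> tangent_space \<A> p \<Longrightarrow> theta \<A> P g D p (P p x) = \<epsilon> * theta \<A> P g D p x"
begin

abbreviation "\<theta> \<equiv> theta \<A> P g D"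

text \<open>The factor of the torsion that remains once \<open>\<lambda> = 0\<close> and \<open>\<mu> = -1/(4n)\<close>.\<close>

definition c :: real where "c = 1 / (4 * real n)"

text \<open>The symmetric form \<open>h = \<epsilon> g - g(\<cdot>, P \<cdot>)\<close>. Its radical contains the \<open>\<epsilon>\<close>-eigenspace of
  \<open>P\<close>, and on the \<open>-\<epsilon>\<close>-eigenspace it is \<open>2 \<epsilon> g\<close>.\<close>

definition h :: "'m \<Rightarrow> 'm tvec \<Rightarrow> 'm tvec \<Rightarrow> real" where
  "h p x y = \<epsilon> * g p x y - g p x (P p y)"

text \<open>The endomorphism \<open>\<epsilon> - P\<close>, which represents \<open>h\<close> with respect to \<open>g\<close>.\<close>

definition H :: "'m \<Rightarrow> 'm tvec \<Rightarrow> 'm tvec" where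
  "H p x = (\<lambda>f. \<epsilon> * x f - P p x f)"

lemma sign_cancel [simp]: "\<epsilon> * (\<epsilon> * r) = r"
  using sign by (simp flip: mult.assoc)

lemma D_linear: "linear_connection \<A> D" and D_metric: "metric_connection \<A> g D"
  using levi_civita unfolding levi_civita_def by simp_all

lemma D'_linear: "linear_connection \<A> D'" and D'_metric: "metric_connection \<A> g D'"
  using canonical
  unfolding canonical_connection_def natural_family_def natural_connection_def by simp_all

lemma H_tangent [simp]: "x \<in> T p \<Longrightarrow> H p x \<in> T p"
  unfolding H_def using tangent_lincomb[of x p "P p x" \<epsilon> "-1"] by simp

lemma g_H: "x \<in> T p \<Longrightarrow> y \<in> T p \<Longrightarrow> g p x (H p y) = h p x y"
  unfolding H_def h_def using g_lincomb_right[of y p "P p y" x \<epsilon> "-1"] by simp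

lemma h_sym: "x \<in> T p \<Longrightarrow> y \<in> T p \<Longrightarrow> h p x y = h p y x"
  unfolding h_def using g_sym[of x p y] g_P_sym[of x p y] g_sym[of "P p x" p y] by simp

lemma h_P: "x \<in> T p \<Longrightarrow> y \<in> T p \<Longrightarrow> h p x (P p y) = - \<epsilon> * h p x y"
  unfolding h_def by (simp add: algebra_simps)

lemma h_lincomb:
  "u \<in> T p \<Longrightarrow> v \<in> T p \<Longrightarrow> x \<in> T p \<Longrightarrow> h p x (\<lambda>f. a * u f + b * v f) = a * h p x u + b * h p x v"
  unfolding h_def by (simp add: P_lincomb g_lincomb_right algebra_simps)

lemma h_eigen:
  assumes "x \<in> T p" "y \<in> T p" "P p y = (\<lambda>f. \<epsilon> * y f)"
  shows "h p x y = 0"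
  unfolding h_def using assms by (simp add: g_scale_right)

lemma h_H: "x \<in> T p \<Longrightarrow> y \<in> T p \<Longrightarrow> h p x (H p y) = 2 * \<epsilon> * h p x y"
  unfolding H_def using h_lincomb[of y p "P p y" x \<epsilon> "-1"] by (simp add: h_P algebra_simps)

lemma theta_lincomb:
  assumes "u \<in> T p" "v \<in> T p"
  shows "\<theta> p (\<lambda>f. a * u f + b * v f) = a * \<theta> p u + b * \<theta> p v"
proof -
  have "cov_endo D P p x (extend \<A> p y) \<in> T p" if x: "x \<in> T p" and y: "y \<in> T p" for x y
  proof -
    obtain W where W: "open W" "p \<in> W" "vector_field \<A> W (extend \<A> p y)"
      using extend_obtain[OF y] .
    show ?thesis
      unfolding cov_endo_def
      by (intro tangent_diff P_tangent connection_tangent[OF D_linear W(1,2) _ x] P_field W)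
  qed
  then have "\<theta> p (\<lambda>f. a * u f + b * v f)
      = metric_trace \<A> g p (\<lambda>x y. a * F_tensor \<A> P g D p x y u + b * F_tensor \<A> P g D p x y v)"
    unfolding theta_def by (intro metric_trace_cong) (simp add: F_tensor_def g_lincomb_right assms)
  then show ?thesis unfolding theta_def by (simp add: metric_trace_lincomb)
qed

text \<open>The relation \<open>\<theta> \<circ> P = \<epsilon> \<theta>\<close> makes \<open>\<theta>\<close> vanish on the \<open>-\<epsilon>\<close>-eigenspace.\<close>

lemma theta_eigen:
  assumes "x \<in> T p" "P p x = (\<lambda>f. - \<epsilon> * x f)"
  shows "\<theta> p x = 0"
proof -
  have "\<epsilon> * \<theta> p x = \<theta> p (\<lambda>f. - \<epsilon> * x f)"
    using theta_P[OF assms(1)] assms(2) by simp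
  also have "\<dots> = - \<epsilon> * \<theta> p x"
    using theta_lincomb[OF assms(1) assms(1), of "- \<epsilon>" 0] by simp
  finally show ?thesis using sign by auto
qed

lemma bracket_D:
  assumes "open W" "p \<in> W" "vector_field \<A> W X" "vector_field \<A> W Y"
  shows "bracket \<A> X Y p = (\<lambda>f. D p (X p) Y f - D p (Y p) X f)"
proof (rule torsion_free_bracket)
  show "torsion_field \<A> D X Y p = (\<lambda>f. 0)"
    using levi_civita assms unfolding levi_civita_def by simp
qed

lemma bracket_tangent:
  assumes "open W" "p \<in> W" "vector_field \<A> W X" "vector_field \<A> W Y"
  shows "bracket \<A> X Y p \<in> T p"
  unfolding bracket_D[OF assms]
  by (intro tangent_diff connection_tangent[OF D_linear assms(1,2)] assms(3,4) vector_field_tangent[OF _ assms(2)])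

lemma canonical_torsion:
  assumes "x \<in> T p" "y \<in> T p" "z \<in> T p"
  shows "torsion_tensor \<A> g D' p x y z = c * (h p y z * \<theta> p x - h p x z * \<theta> p y)"
proof -
  have "torsion_tensor \<A> g D' p x y z =
          1 / (2 * real n) * (g p y z * \<theta> p (P p x) - g p x z * \<theta> p (P p y))
          + - 1 / (4 * real n) * (g p y (P p z) * \<theta> p x - g p x (P p z) * \<theta> p y
                 + g p y z * \<theta> p (P p x) - g p x z * \<theta> p (P p y))"
    using canonical assms unfolding canonical_connection_def natural_family_def Let_def by simp
  moreover have "1 / (2 * real n) = 2 * c" "- 1 / (4 * real n) = - c"
    by (simp_all add: c_def)
  ultimately show ?thesis
    by (simp only: theta_P assms h_def) (simp add: algebra_simps)
qed

section \<open>The difference between the canonical and the Levi-Civita connection\<close>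

text \<open>A metric connection is recovered from its torsion. The difference tensor \<open>B\<close> is skew in its
  last two arguments, and \<open>B x y z - B y x z\<close> is the torsion of \<open>D'\<close>, because the Levi-Civita
  connection is torsion free.\<close>

lemma difference_extend:
  assumes x: "x \<in> T p" and y: "y \<in> T p" and z: "z \<in> T p"
  shows "g p (D' p x (extend \<A> p y)) z - g p (D p x (extend \<A> p y)) z
    = c * (h p x y * \<theta> p z - h p x z * \<theta> p y)"
proof -
  define B where "B x y z = g p (D' p x (extend \<A> p y)) z - g p (D p x (extend \<A> p y)) z" for x y z
  have skew: "B x y z = - B x z y" if "x \<in> T p" "y \<in> T p" "z \<in> T p" for x y z
  proof -
    obtain W where "open W" "p \<in> W" "vector_field \<A> W (extend \<A> p y)" "vector_field \<A> W (extend \<A> p z)"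
      "extend \<A> p y p = y" "extend \<A> p z p = z"
      using common_domain[OF \<open>y \<in> T p\<close> \<open>z \<in> T p\<close>] .
    then show ?thesis
      using metric_difference_skew[OF D_linear D_metric D'_linear D'_metric, of W p "extend \<A> p y" "extend \<A> p z" x]
        that by (simp add: B_def)
  qed
  have tors: "B x y z - B y x z = c * (h p y z * \<theta> p x - h p x z * \<theta> p y)"
    if "x \<in> T p" "y \<in> T p" "z \<in> T p" for x y z
  proof -
    obtain W where W: "open W" "p \<in> W" and X: "vector_field \<A> W (extend \<A> p x)"
      and Y: "vector_field \<A> W (extend \<A> p y)" and v: "extend \<A> p x p = x" "extend \<A> p y p = y"
      using common_domain[OF \<open>x \<in> T p\<close> \<open>y \<in> T p\<close>] .
    let ?X = "extend \<A> p x" and ?Y = "extend \<A> p y"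
    have t: "D' p x ?Y \<in> T p" "D' p y ?X \<in> T p" "D p x ?Y \<in> T p" "D p y ?X \<in> T p"
      by (intro connection_tangent[OF D_linear W] connection_tangent[OF D'_linear W] X Y that)+
    have "torsion_field \<A> D' ?X ?Y p
        = (\<lambda>f. (D' p x ?Y f - D' p y ?X f) - (D p x ?Y f - D p y ?X f))"
      unfolding torsion_field_def bracket_D[OF W X Y] cov_def v ..
    then have "torsion_tensor \<A> g D' p x y z = B x y z - B y x z"
      using t that(3) by (simp add: torsion_tensor_def g_diff_left tangent_diff B_def)
    then show ?thesis using canonical_torsion[OF that] by simp
  qed
  \<comment> \<open>The Koszul permutation: by skewness all terms but the two copies of \<open>B x y z\<close> cancel.\<close>
  have "2 * B x y z = (B x y z - B y x z) - (B y z x - B z y x) + (B z x y - B x z y)"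
    using skew[OF x y z] skew[OF y x z] skew[OF z x y] by simp
  also have "\<dots> = 2 * (c * (h p x y * \<theta> p z - h p x z * \<theta> p y))"
    unfolding tors[OF x y z] tors[OF y z x] tors[OF z x y]
    using h_sym[OF x y] h_sym[OF x z] h_sym[OF y z] by (simp add: algebra_simps)
  finally show ?thesis by (simp add: B_def)
qed

lemma difference:
  assumes W: "open W" "p \<in> W" "vector_field \<A> W Y" and v: "v \<in> T p" and z: "z \<in> T p"
  shows "g p (D' p v Y) z = g p (D p v Y) z + c * (h p v (Y p) * \<theta> p z - h p v z * \<theta> p (Y p))"
proof -
  have y: "Y p \<in> T p" by (rule vector_field_tangent[OF W(3,2)])
  obtain V where V: "open V" "p \<in> V" "vector_field \<A> V (extend \<A> p (Y p))" "extend \<A> p (Y p) p = Y p"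
    using extend_obtain[OF y] .
  show ?thesis
    using metric_difference_tensorial[OF D_linear D_metric D'_linear D'_metric W V(1-3) V(4)[symmetric] v z]
      difference_extend[OF v y z] by simp
qed

text \<open>Since \<open>D'\<close> makes \<open>P\<close> parallel, it preserves the sections of each eigenbundle.\<close>

lemma D'_eigen:
  assumes W: "open W" "p \<in> W" "vector_field \<A> W Y" and v: "v \<in> T p"
    and eig: "\<And>q. q \<in> W \<Longrightarrow> P q (Y q) = (\<lambda>f. s * Y q f)"
  shows "P p (D' p v Y) = (\<lambda>f. s * D' p v Y f)"
proof -
  have "cov_endo D' P p v Y = (\<lambda>f. 0)"
    using canonical W v
    unfolding canonical_connection_def natural_family_def natural_connection_def by simp
  then have "P p (D' p v Y) = D' p v (\<lambda>q. P q (Y q))"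
    by (auto simp: cov_endo_def fun_eq_iff)
  also have "\<dots> = D' p v (\<lambda>q f. s * Y q f)"
    using vector_field_lincomb[OF W(1,3,3), of s 0]
    by (intro connection_cong[OF D'_linear W(1,2) P_field[OF W(1,3)] _ eig v]) simp_all
  also have "\<dots> = (\<lambda>f. s * D' p v Y f)"
    by (rule connection_scale[OF D'_linear W v])
  finally show ?thesis .
qed

section \<open>Second fundamental forms of the eigenbundles\<close>

text \<open>For two sections \<open>Z\<close>, \<open>Z'\<close> of the same eigenbundle, \<open>D\<close> differs from \<open>D'\<close> by a second
  fundamental form with values in the other eigenbundle. Its contribution to
  \<open>g(D\<^sub>u Z, D\<^sub>v Z')\<close> is symmetric in \<open>u\<close> and \<open>v\<close> on the \<open>\<epsilon>\<close>-eigenbundle, where it will cancel in the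
  curvature. On the \<open>-\<epsilon>\<close>-eigenbundle the form is \<open>h \<otimes> \<Omega>\<close> up to a factor, with \<open>\<Omega>\<close> dual
  to \<open>\<theta>\<close>.\<close>

lemma gauss_plus:
  assumes W: "open W" "p \<in> W" and Z: "vector_field \<A> W Z" and Z': "vector_field \<A> W Z'"
    and u: "u \<in> T p" and v: "v \<in> T p"
    and eig: "\<And>q. q \<in> W \<Longrightarrow> P q (Z q) = (\<lambda>f. \<epsilon> * Z q f)" "\<And>q. q \<in> W \<Longrightarrow> P q (Z' q) = (\<lambda>f. \<epsilon> * Z' q f)"
  shows "g p (D p u Z) (D p v Z') - g p (D' p u Z) (D' p v Z')
    = 2 * \<epsilon> * c\<^sup>2 * \<theta> p (Z p) * \<theta> p (Z' p) * h p u v"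
proof -
  have t: "Z p \<in> T p" "Z' p \<in> T p" "D p u Z \<in> T p" "D p v Z' \<in> T p" "D' p u Z \<in> T p" "D' p v Z' \<in> T p"
    by (intro vector_field_tangent[OF _ W(2)] connection_tangent[OF D_linear W]
        connection_tangent[OF D'_linear W] Z Z' u v)+
  have e: "P p (Z p) = (\<lambda>f. \<epsilon> * Z p f)" "P p (Z' p) = (\<lambda>f. \<epsilon> * Z' p f)"
    by (intro eig W)+
  have e': "P p (D' p u Z) = (\<lambda>f. \<epsilon> * D' p u Z f)" "P p (D' p v Z') = (\<lambda>f. \<epsilon> * D' p v Z' f)"
    by (rule D'_eigen[OF W Z u eig(1)] D'_eigen[OF W Z' v eig(2)]; assumption)+
  have "g p (D' p u Z) (D' p v Z') = g p (D' p u Z) (D p v Z')"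
    using difference[OF W Z' v t(5)] g_sym[OF t(5) t(6)] g_sym[OF t(5) t(4)]
    by (simp add: h_eigen[OF v t(2) e(2)] h_eigen[OF v t(5) e'(1)])
  moreover have "g p (D' p u Z) (D p v Z') = g p (D p u Z) (D p v Z') - c * h p u (D p v Z') * \<theta> p (Z p)"
    using difference[OF W Z u t(4)] by (simp add: h_eigen[OF u t(1) e(1)])
  moreover have "h p u (D p v Z') = 2 * \<epsilon> * c * \<theta> p (Z' p) * h p u v"
  proof -
    have "h p u (D p v Z') = g p (D p v Z') (H p u)"
      using g_H[OF t(4) u] h_sym[OF u t(4)] by simp
    moreover have "g p (D' p v Z') (H p u) = 0"
      using g_H[OF t(6) u] h_sym[OF u t(6)] h_eigen[OF u t(6) e'(2)] by simp
    ultimately show ?thesis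
      using difference[OF W Z' v H_tangent[OF u]]
      by (simp add: h_eigen[OF v t(2) e(2)] h_H[OF v u] h_sym[OF v u])
  qed
  ultimately show ?thesis by (simp add: power2_eq_square)
qed

lemma gauss_minus:
  assumes W: "open W" "p \<in> W" and Z: "vector_field \<A> W Z" and Z': "vector_field \<A> W Z'"
    and u: "u \<in> T p" and v: "v \<in> T p"
    and eig: "\<And>q. q \<in> W \<Longrightarrow> P q (Z q) = (\<lambda>f. - \<epsilon> * Z q f)" "\<And>q. q \<in> W \<Longrightarrow> P q (Z' q) = (\<lambda>f. - \<epsilon> * Z' q f)"
    and \<Omega>: "\<Omega> \<in> T p" "\<And>u. u \<in> T p \<Longrightarrow> g p \<Omega> u = \<theta> p u"
  shows "g p (D p u Z) (D p v Z') - g p (D' p u Z) (D' p v Z')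
    = c\<^sup>2 * \<theta> p \<Omega> * (h p u (Z p) * h p v (Z' p))"
proof -
  have t: "Z p \<in> T p" "Z' p \<in> T p" "D p u Z \<in> T p" "D p v Z' \<in> T p" "D' p u Z \<in> T p" "D' p v Z' \<in> T p"
    by (intro vector_field_tangent[OF _ W(2)] connection_tangent[OF D_linear W]
        connection_tangent[OF D'_linear W] Z Z' u v)+
  have e: "P p (Z p) = (\<lambda>f. - \<epsilon> * Z p f)" "P p (Z' p) = (\<lambda>f. - \<epsilon> * Z' p f)"
    by (intro eig W)+
  have e': "P p (D' p u Z) = (\<lambda>f. - \<epsilon> * D' p u Z f)" "P p (D' p v Z') = (\<lambda>f. - \<epsilon> * D' p v Z' f)"
    by (rule D'_eigen[OF W Z u eig(1)] D'_eigen[OF W Z' v eig(2)]; assumption)+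
  have "g p (D' p u Z) (D' p v Z') = g p (D' p u Z) (D p v Z')"
    using difference[OF W Z' v t(5)] g_sym[OF t(5) t(6)] g_sym[OF t(5) t(4)]
    by (simp add: theta_eigen[OF t(2) e(2)] theta_eigen[OF t(5) e'(1)])
  moreover have "g p (D' p u Z) (D p v Z') = g p (D p u Z) (D p v Z') + c * h p u (Z p) * \<theta> p (D p v Z')"
    using difference[OF W Z u t(4)] by (simp add: theta_eigen[OF t(1) e(1)])
  moreover have "\<theta> p (D p v Z') = - c * \<theta> p \<Omega> * h p v (Z' p)"
  proof -
    have "\<theta> p (D p v Z') = g p (D p v Z') \<Omega>"
      using \<Omega>(2)[OF t(4)] g_sym[OF \<Omega>(1) t(4)] by simp
    moreover have "g p (D' p v Z') \<Omega> = 0"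
      using \<Omega>(2)[OF t(6)] g_sym[OF \<Omega>(1) t(6)] theta_eigen[OF t(6) e'(2)] by simp
    ultimately show ?thesis
      using difference[OF W Z' v \<Omega>(1)] by (simp add: theta_eigen[OF t(2) e(2)] eq_neg_iff_add_eq_0 ac_simps)
  qed
  ultimately show ?thesis by (simp add: power2_eq_square)
qed

section \<open>Comparison of the two curvatures\<close>

text \<open>The hypothesis \<open>cancel\<close> says that \<open>g(D'\<^sub>v Z, Z') = g(D\<^sub>v Z, Z')\<close> near \<open>p\<close>, so that the terms with
  derivatives of functions agree in the two curvatures.\<close>

lemma curvature_comparison:
  assumes W: "open W" "p \<in> W" and X: "vector_field \<A> W X" and Y: "vector_field \<A> W Y"
    and Z: "vector_field \<A> W Z" and Z': "vector_field \<A> W Z'"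
    and cancel: "\<And>q v. q \<in> W \<Longrightarrow> v \<in> T q \<Longrightarrow> h q v (Z q) * \<theta> q (Z' q) = h q v (Z' q) * \<theta> q (Z q)"
  shows "g p (curvature_field \<A> D' X Y Z p) (Z' p) = g p (curvature_field \<A> D X Y Z p) (Z' p)
    + (g p (D p (Y p) Z) (D p (X p) Z') - g p (D' p (Y p) Z) (D' p (X p) Z'))
    - (g p (D p (X p) Z) (D p (Y p) Z') - g p (D' p (X p) Z) (D' p (Y p) Z'))"
proof -
  have br: "bracket \<A> X Y p \<in> T p" by (rule bracket_tangent[OF W X Y])
  have eq: "g q (D' q v Z) (Z' q) = g q (D q v Z) (Z' q)" if "q \<in> W" "v \<in> T q" for q v
    using difference[OF W(1) that(1) Z that(2) vector_field_tangent[OF Z' that(1)]] cancel[OF that] by simp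
  have deriv: "u (\<lambda>q. g q (D' q (V q) Z) (Z' q)) = u (\<lambda>q. g q (D q (V q) Z) (Z' q))"
    if "u \<in> T p" "vector_field \<A> W V" for u V
    by (rule tangent_cong[OF that(1) W]) (rule eq, assumption, rule vector_field_tangent[OF that(2)])
  show ?thesis
    unfolding curvature_pairing[OF D_linear D_metric W X Y Z Z' br]
      curvature_pairing[OF D'_linear D'_metric W X Y Z Z' br]
      eq[OF W(2) br] deriv[OF vector_field_tangent[OF X W(2)] Y] deriv[OF vector_field_tangent[OF Y W(2)] X]
    by simp
qed

text \<open>In the third argument the curvature tensor may be computed with any field extending the vector, in
  particular with an eigensection.\<close>

lemma curvature_tensor_eq:
  assumes D: "linear_connection \<A> D0" "metric_connection \<A> g D0"
    and x: "x \<in> T p" and y: "y \<in> T p" and w: "w \<in> T p"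
    and Z: "open V" "p \<in> V" "vector_field \<A> V Z"
  shows "curvature_tensor \<A> g D0 p x y (Z p) w
    = g p (curvature_field \<A> D0 (extend \<A> p x) (extend \<A> p y) Z p) w"
proof -
  have z: "Z p \<in> T p" by (rule vector_field_tangent[OF Z(3,2)])
  obtain W where W: "open W" "p \<in> W" "vector_field \<A> W (extend \<A> p x)" "vector_field \<A> W (extend \<A> p y)"
    using common_domain[OF x y] .
  obtain U where U: "open U" "p \<in> U" "vector_field \<A> U (extend \<A> p (Z p))" "extend \<A> p (Z p) p = Z p"
    using extend_obtain[OF z] .
  have S: "open (U \<inter> W)" "p \<in> U \<inter> W" using U W by (simp_all add: open_Int)
  have f: "vector_field \<A> (U \<inter> W) (extend \<A> p x)" "vector_field \<A> (U \<inter> W) (extend \<A> p y)"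
    "vector_field \<A> (U \<inter> W) (extend \<A> p (Z p))"
    by (rule vector_field_subset[OF U(3)] vector_field_subset[OF W(3)] vector_field_subset[OF W(4)]; blast)+
  show ?thesis
    unfolding curvature_tensor_def
    by (rule curvature_tensorial[OF D S f bracket_tangent[OF S f(1,2)] Z U(4) w])
qed

lemma curvature_tensor_lincomb_right:
  assumes D: "linear_connection \<A> D0"
    and x: "x \<in> T p" and y: "y \<in> T p" and z: "z \<in> T p" and u: "u \<in> T p" and v: "v \<in> T p"
  shows "curvature_tensor \<A> g D0 p x y z (\<lambda>f. a * u f + b * v f)
    = a * curvature_tensor \<A> g D0 p x y z u + b * curvature_tensor \<A> g D0 p x y z v"
proof -
  obtain W where W: "open W" "p \<in> W" "vector_field \<A> W (extend \<A> p x)" "vector_field \<A> W (extend \<A> p y)"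
    using common_domain[OF x y] .
  obtain U where U: "open U" "p \<in> U" "vector_field \<A> U (extend \<A> p z)"
    using extend_obtain[OF z] .
  have S: "open (U \<inter> W)" "p \<in> U \<inter> W" using U W by (simp_all add: open_Int)
  have f: "vector_field \<A> (U \<inter> W) (extend \<A> p x)" "vector_field \<A> (U \<inter> W) (extend \<A> p y)"
    "vector_field \<A> (U \<inter> W) (extend \<A> p z)"
    by (rule vector_field_subset[OF U(3)] vector_field_subset[OF W(3)] vector_field_subset[OF W(4)]; blast)+
  show ?thesis
    unfolding curvature_tensor_def
    by (rule g_lincomb_right[OF u v curvature_field_tangent[OF D S f bracket_tangent[OF S f(1,2)]]])
qed

lemma curvature_tensor_skew:
  assumes D: "linear_connection \<A> D0" "metric_connection \<A> g D0"
    and x: "x \<in> T p" and y: "y \<in> T p" and z: "z \<in> T p" and w: "w \<in> T p"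
  shows "curvature_tensor \<A> g D0 p x y z w = - curvature_tensor \<A> g D0 p x y w z"
proof -
  obtain W where W: "open W" "p \<in> W" "vector_field \<A> W (extend \<A> p x)" "vector_field \<A> W (extend \<A> p y)"
    using common_domain[OF x y] .
  obtain U where U: "open U" "p \<in> U" "vector_field \<A> U (extend \<A> p z)" "vector_field \<A> U (extend \<A> p w)"
    "extend \<A> p z p = z" "extend \<A> p w p = w"
    using common_domain[OF z w] .
  have S: "open (U \<inter> W)" "p \<in> U \<inter> W" using U W by (simp_all add: open_Int)
  have f: "vector_field \<A> (U \<inter> W) (extend \<A> p x)" "vector_field \<A> (U \<inter> W) (extend \<A> p y)"
    "vector_field \<A> (U \<inter> W) (extend \<A> p z)" "vector_field \<A> (U \<inter> W) (extend \<A> p w)"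
    by (rule vector_field_subset[OF U(3)] vector_field_subset[OF U(4)]
        vector_field_subset[OF W(3)] vector_field_subset[OF W(4)]; blast)+
  show ?thesis
    using curvature_skew[OF D S f bracket_tangent[OF S f(1,2)]]
    by (simp add: curvature_tensor_def U(5,6))
qed

lemma curvature_tensor_lincomb_left:
  assumes D: "linear_connection \<A> D0" "metric_connection \<A> g D0"
    and x: "x \<in> T p" and y: "y \<in> T p" and w: "w \<in> T p" and u: "u \<in> T p" and v: "v \<in> T p"
  shows "curvature_tensor \<A> g D0 p x y (\<lambda>f. a * u f + b * v f) w
    = a * curvature_tensor \<A> g D0 p x y u w + b * curvature_tensor \<A> g D0 p x y v w"
  unfolding curvature_tensor_skew[OF D x y tangent_lincomb[OF u v] w] curvature_tensor_skew[OF D x y u w]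
    curvature_tensor_skew[OF D x y v w] curvature_tensor_lincomb_right[OF D(1) x y w u v]
  by simp

text \<open>The operators \<open>R'(x,y)\<close> preserve the eigenspaces of \<open>P\<close>, and these are orthogonal.\<close>

lemma D'_curvature_mixed:
  assumes x: "x \<in> T p" and y: "y \<in> T p" and z: "z \<in> T p" and w: "w \<in> T p"
    and s: "s * s = 1" and Pz: "P p z = (\<lambda>f. s * z f)" and Pw: "P p w = (\<lambda>f. - s * w f)"
  shows "curvature_tensor \<A> g D' p x y z w = 0"
proof -
  obtain V Z where V: "open V" "p \<in> V" "vector_field \<A> V Z" "Z p = z"
    "\<forall>q\<in>V. P q (Z q) = (\<lambda>f. s * Z q f)"
    using eigen_extension[OF z s Pz] .
  obtain W where W: "open W" "p \<in> W" "vector_field \<A> W (extend \<A> p x)" "vector_field \<A> W (extend \<A> p y)"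
    "extend \<A> p x p = x" "extend \<A> p y p = y"
    using common_domain[OF x y] .
  let ?X = "extend \<A> p x" and ?Y = "extend \<A> p y"
  have S: "open (V \<inter> W)" "p \<in> V \<inter> W" using V W by (simp_all add: open_Int)
  have f: "vector_field \<A> (V \<inter> W) ?X" "vector_field \<A> (V \<inter> W) ?Y" "vector_field \<A> (V \<inter> W) Z"
    by (rule vector_field_subset[OF V(3)] vector_field_subset[OF W(3)] vector_field_subset[OF W(4)]; blast)+
  have br: "bracket \<A> ?X ?Y p \<in> T p" by (rule bracket_tangent[OF S f(1,2)])
  have fc: "vector_field \<A> (V \<inter> W) (cov D' ?Y Z)" "vector_field \<A> (V \<inter> W) (cov D' ?X Z)"
    by (intro connection_field D'_linear S f)+
  have e: "P q (D' q v Z) = (\<lambda>f. s * D' q v Z f)" if "q \<in> V \<inter> W" "v \<in> T q" for q v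
    by (rule D'_eigen[OF S(1) that(1) f(3) that(2)]) (simp add: V(5))
  have ec: "P p (D' p v (cov D' U Z)) = (\<lambda>f. s * D' p v (cov D' U Z) f)"
    if v: "v \<in> T p" and U: "vector_field \<A> (V \<inter> W) U" for v U
  proof (rule D'_eigen[OF S connection_field[OF D'_linear S(1) U f(3)] v])
    show "P q (cov D' U Z q) = (\<lambda>f. s * cov D' U Z q f)" if "q \<in> V \<inter> W" for q
      unfolding cov_def by (rule e[OF that vector_field_tangent[OF U that]])
  qed
  have t: "D' p x (cov D' ?Y Z) \<in> T p" "D' p y (cov D' ?X Z) \<in> T p" "D' p (bracket \<A> ?X ?Y p) Z \<in> T p"
    by (intro connection_tangent[OF D'_linear S] fc f x y br)+
  have R: "curvature_field \<A> D' ?X ?Y Z p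
    = (\<lambda>f. (D' p x (cov D' ?Y Z) f - D' p y (cov D' ?X Z) f) - D' p (bracket \<A> ?X ?Y p) Z f)"
    unfolding curvature_field_def cov_def W(5,6) ..
  have "P p (curvature_field \<A> D' ?X ?Y Z p) = (\<lambda>f. s * curvature_field \<A> D' ?X ?Y Z p f)"
    unfolding R
    by (rule eigenvector_diff[OF tangent_diff[OF t(1,2)] t(3)
          eigenvector_diff[OF t(1,2) ec[OF x f(2)] ec[OF y f(1)]] e[OF S(2) br]])
  then have "g p (curvature_field \<A> D' ?X ?Y Z p) w = 0"
    by (rule g_eigen_orthogonal[OF curvature_field_tangent[OF D'_linear S f br] w s _ Pw])
  then show ?thesis
    using curvature_tensor_eq[OF D'_linear D'_metric x y w V(1-3)] V(4) by simp
qed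

lemma curvature_eigen:
  assumes x: "x \<in> T p" and y: "y \<in> T p" and z: "z \<in> T p" and w: "w \<in> T p"
    and s: "s * s = 1" and Pz: "P p z = (\<lambda>f. s * z f)" and Pw: "P p w = (\<lambda>f. s * w f)"
  obtains W X Y Z Z' where "open W" "p \<in> W" "vector_field \<A> W X" "vector_field \<A> W Y"
    "vector_field \<A> W Z" "vector_field \<A> W Z'" "X p = x" "Y p = y" "Z p = z" "Z' p = w"
    "\<forall>q\<in>W. P q (Z q) = (\<lambda>f. s * Z q f)" "\<forall>q\<in>W. P q (Z' q) = (\<lambda>f. s * Z' q f)"
    "curvature_tensor \<A> g D p x y z w = g p (curvature_field \<A> D X Y Z p) w"
    "curvature_tensor \<A> g D' p x y z w = g p (curvature_field \<A> D' X Y Z p) w"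
proof -
  obtain V Z where V: "open V" "p \<in> V" "vector_field \<A> V Z" "Z p = z"
    "\<forall>q\<in>V. P q (Z q) = (\<lambda>f. s * Z q f)"
    using eigen_extension[OF z s Pz] .
  obtain V' Z' where V': "open V'" "p \<in> V'" "vector_field \<A> V' Z'" "Z' p = w"
    "\<forall>q\<in>V'. P q (Z' q) = (\<lambda>f. s * Z' q f)"
    using eigen_extension[OF w s Pw] .
  obtain U where U: "open U" "p \<in> U" "vector_field \<A> U (extend \<A> p x)" "vector_field \<A> U (extend \<A> p y)"
    "extend \<A> p x p = x" "extend \<A> p y p = y"
    using common_domain[OF x y] .
  show ?thesis
  proof (rule that[of "V \<inter> V' \<inter> U" "extend \<A> p x" "extend \<A> p y" Z Z'])
    show "open (V \<inter> V' \<inter> U)" "p \<in> V \<inter> V' \<inter> U" using V V' U by (simp_all add: open_Int)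
    show "vector_field \<A> (V \<inter> V' \<inter> U) (extend \<A> p x)" "vector_field \<A> (V \<inter> V' \<inter> U) (extend \<A> p y)"
      "vector_field \<A> (V \<inter> V' \<inter> U) Z" "vector_field \<A> (V \<inter> V' \<inter> U) Z'"
      by (rule vector_field_subset[OF V(3)] vector_field_subset[OF V'(3)]
          vector_field_subset[OF U(3)] vector_field_subset[OF U(4)]; blast)+
    show "curvature_tensor \<A> g D p x y z w = g p (curvature_field \<A> D (extend \<A> p x) (extend \<A> p y) Z p) w"
      using curvature_tensor_eq[OF D_linear D_metric x y w V(1-3)] V(4) by simp
    show "curvature_tensor \<A> g D' p x y z w = g p (curvature_field \<A> D' (extend \<A> p x) (extend \<A> p y) Z p) w"
      using curvature_tensor_eq[OF D'_linear D'_metric x y w V(1-3)] V(4) by simp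
  qed (use V V' U in simp_all)
qed

lemma curvature_plus:
  assumes x: "x \<in> T p" and y: "y \<in> T p" and z: "z \<in> T p" and w: "w \<in> T p"
    and Pz: "P p z = (\<lambda>f. \<epsilon> * z f)" and Pw: "P p w = (\<lambda>f. \<epsilon> * w f)"
  shows "curvature_tensor \<A> g D' p x y z w = curvature_tensor \<A> g D p x y z w"
proof -
  obtain W X Y Z Z' where W: "open W" "p \<in> W" and f: "vector_field \<A> W X" "vector_field \<A> W Y"
    "vector_field \<A> W Z" "vector_field \<A> W Z'" and v: "X p = x" "Y p = y" "Z p = z" "Z' p = w"
    and eig: "\<forall>q\<in>W. P q (Z q) = (\<lambda>f. \<epsilon> * Z q f)" "\<forall>q\<in>W. P q (Z' q) = (\<lambda>f. \<epsilon> * Z' q f)"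
    and R: "curvature_tensor \<A> g D p x y z w = g p (curvature_field \<A> D X Y Z p) w"
    "curvature_tensor \<A> g D' p x y z w = g p (curvature_field \<A> D' X Y Z p) w"
    using curvature_eigen[OF x y z w sign Pz Pw] .
  note e = eig[rule_format]
  have "h q u (Z q) * \<theta> q (Z' q) = h q u (Z' q) * \<theta> q (Z q)" if "q \<in> W" "u \<in> T q" for q u
    using h_eigen[OF that(2) vector_field_tangent[OF f(3) that(1)] e(1)[OF that(1)]]
      h_eigen[OF that(2) vector_field_tangent[OF f(4) that(1)] e(2)[OF that(1)]] by simp
  from curvature_comparison[OF W f this] show ?thesis
    using gauss_plus[OF W f(3,4) x y e] gauss_plus[OF W f(3,4) y x e] h_sym[OF x y]
    by (simp add: R v)
qed

lemma curvature_minus: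
  assumes x: "x \<in> T p" and y: "y \<in> T p" and z: "z \<in> T p" and w: "w \<in> T p"
    and Pz: "P p z = (\<lambda>f. - \<epsilon> * z f)" and Pw: "P p w = (\<lambda>f. - \<epsilon> * w f)"
    and \<Omega>: "\<Omega> \<in> T p" "\<And>u. u \<in> T p \<Longrightarrow> g p \<Omega> u = \<theta> p u"
  shows "curvature_tensor \<A> g D' p x y z w = curvature_tensor \<A> g D p x y z w
    + c\<^sup>2 * \<theta> p \<Omega> * (h p y z * h p x w - h p x z * h p y w)"
proof -
  have s: "- \<epsilon> * - \<epsilon> = 1" using sign by simp
  obtain W X Y Z Z' where W: "open W" "p \<in> W" and f: "vector_field \<A> W X" "vector_field \<A> W Y"
    "vector_field \<A> W Z" "vector_field \<A> W Z'" and v: "X p = x" "Y p = y" "Z p = z" "Z' p = w"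
    and eig: "\<forall>q\<in>W. P q (Z q) = (\<lambda>f. - \<epsilon> * Z q f)" "\<forall>q\<in>W. P q (Z' q) = (\<lambda>f. - \<epsilon> * Z' q f)"
    and R: "curvature_tensor \<A> g D p x y z w = g p (curvature_field \<A> D X Y Z p) w"
    "curvature_tensor \<A> g D' p x y z w = g p (curvature_field \<A> D' X Y Z p) w"
    using curvature_eigen[OF x y z w s Pz Pw] .
  note e = eig[rule_format]
  have "h q u (Z q) * \<theta> q (Z' q) = h q u (Z' q) * \<theta> q (Z q)" if "q \<in> W" "u \<in> T q" for q u
    using theta_eigen[OF vector_field_tangent[OF f(3) that(1)] e(1)[OF that(1)]]
      theta_eigen[OF vector_field_tangent[OF f(4) that(1)] e(2)[OF that(1)]] by simp
  from curvature_comparison[OF W f this] show ?thesis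
    using gauss_minus[OF W f(3,4) x y e \<Omega>] gauss_minus[OF W f(3,4) y x e \<Omega>]
    by (simp add: R v algebra_simps)
qed

text \<open>The key identity \<open>R' = K + c\<^sup>2 \<theta>(\<Omega>) \<Pi>\<close>, where \<open>\<Pi>(x,y,z,w) = h(y,z)h(x,w) - h(x,z)h(y,w)\<close>
  equals \<open>\<pi>\<^sub>1 + \<pi>\<^sub>2 - \<epsilon> \<pi>\<^sub>3\<close>. The averaging in \<open>K\<close> removes the components of \<open>R\<close> that mix the
  two eigenspaces.\<close>

lemma canonical_curvature:
  assumes x: "x \<in> T p" and y: "y \<in> T p" and z: "z \<in> T p" and w: "w \<in> T p"
    and \<Omega>: "\<Omega> \<in> T p" "\<And>u. u \<in> T p \<Longrightarrow> g p \<Omega> u = \<theta> p u"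
  shows "curvature_tensor \<A> g D' p x y z w = K_tensor \<A> P g D p x y z w
    + c\<^sup>2 * \<theta> p \<Omega> * (h p y z * h p x w - h p x z * h p y w)"
proof -
  \<comment> \<open>The projection onto the \<open>s\<close>-eigenspace of \<open>P\<close>.\<close>
  define pr where "pr s v = (\<lambda>f. (1/2) * v f + (s/2) * P p v f)" for s :: real and v :: "'m tvec"
  let ?z = "pr \<epsilon> z" and ?z' = "pr (- \<epsilon>) z" and ?w = "pr \<epsilon> w" and ?w' = "pr (- \<epsilon>) w"
  have pr: "pr s v \<in> T p" if "v \<in> T p" for s v
    unfolding pr_def using that by (intro tangent_lincomb) simp_all
  have P_pr: "P p (pr s v) = (\<lambda>f. s * pr s v f)" if "v \<in> T p" "s * s = 1" for s v
  proof -
    have ss: "s * (s * r) = r" for r using that(2) by (simp flip: mult.assoc)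
    show ?thesis
      unfolding pr_def P_lincomb[OF that(1) P_tangent[OF that(1)]]
      by (simp add: that(1) algebra_simps ss)
  qed
  have split: "v = (\<lambda>f. 1 * pr \<epsilon> v f + 1 * pr (- \<epsilon>) v f)" for v
    by (simp add: pr_def)
  have P_split: "P p v = (\<lambda>f. \<epsilon> * pr \<epsilon> v f + (- \<epsilon>) * pr (- \<epsilon>) v f)" for v
    by (simp add: pr_def algebra_simps)
  have s: "- \<epsilon> * - \<epsilon> = 1" using sign by simp
  note t = pr[OF z, of \<epsilon>] pr[OF z, of "- \<epsilon>"] pr[OF w, of \<epsilon>] pr[OF w, of "- \<epsilon>"]
  note e = P_pr[OF z sign] P_pr[OF z s] P_pr[OF w sign] P_pr[OF w s]
  have bilinear: "curvature_tensor \<A> g D0 p x y (\<lambda>f. a * ?z f + b * ?z' f) (\<lambda>f. a * ?w f + b * ?w' f)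
      = a * a * curvature_tensor \<A> g D0 p x y ?z ?w + a * b * curvature_tensor \<A> g D0 p x y ?z ?w'
      + a * b * curvature_tensor \<A> g D0 p x y ?z' ?w + b * b * curvature_tensor \<A> g D0 p x y ?z' ?w'"
    if D: "linear_connection \<A> D0" "metric_connection \<A> g D0" for D0 a b
    using curvature_tensor_lincomb_left[OF D x y tangent_lincomb[OF t(3,4)] t(1,2)]
      curvature_tensor_lincomb_right[OF D(1) x y t(1) t(3,4)]
      curvature_tensor_lincomb_right[OF D(1) x y t(2) t(3,4)]
    by (simp add: algebra_simps)
  have "curvature_tensor \<A> g D' p x y z w
      = curvature_tensor \<A> g D' p x y ?z ?w + curvature_tensor \<A> g D' p x y ?z' ?w'"
    using bilinear[OF D'_linear D'_metric, of 1 1] split[of z, symmetric] split[of w, symmetric]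
      D'_curvature_mixed[OF x y t(1) t(4) sign e(1) e(4)]
      D'_curvature_mixed[OF x y t(2) t(3) s e(2)] e(3)
    by simp
  moreover have "K_tensor \<A> P g D p x y z w
      = curvature_tensor \<A> g D p x y ?z ?w + curvature_tensor \<A> g D p x y ?z' ?w'"
    using bilinear[OF D_linear D_metric, of 1 1] split[of z, symmetric] split[of w, symmetric]
      bilinear[OF D_linear D_metric, of \<epsilon> "- \<epsilon>"] P_split[of z, symmetric] P_split[of w, symmetric]
    by (simp add: K_tensor_def sign)
  moreover have "h p u (pr (- \<epsilon>) v) = h p u v" if u: "u \<in> T p" and v: "v \<in> T p" for u v
    unfolding pr_def h_lincomb[OF v P_tangent[OF v] u] by (simp add: h_P[OF u v])
  ultimately show ?thesis
    using curvature_plus[OF x y t(1,3) e(1,3)] curvature_minus[OF x y t(2,4) e(2,4) \<Omega>] x y z w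
    by simp
qed

section \<open>Scalar curvatures and the tensor A\<close>

lemma pi_combination:
  assumes "x \<in> T p" "y \<in> T p" "z \<in> T p" "w \<in> T p"
  shows "pi1 (g p) x y z w + pi2 (P p) (g p) x y z w - \<epsilon> * pi3 (P p) (g p) x y z w
    = h p y z * h p x w - h p x z * h p y w"
proof -
  have "h p a b * h p a' b' = g p a b * g p a' b' + g p a (P p b) * g p a' (P p b')
      - \<epsilon> * (g p a b * g p a' (P p b') + g p a (P p b) * g p a' b')" for a b a' b'
    unfolding h_def by (simp add: algebra_simps)
  note expand = this
  show ?thesis
    unfolding expand using assms by (simp add: pi1_def pi2_def pi3_def psi1_def psi2_def algebra_simps)
qed

lemma metric_trace_h:
  assumes "endo_trace \<A> p (P p) = 0"
  shows "metric_trace \<A> g p (h p) = \<epsilon> * real CARD('d)"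
  using metric_trace_lincomb[of p \<epsilon> "g p" "-1" "\<lambda>u v. g p u (P p v)"] assms
  by (simp add: h_def[abs_def] metric_trace_metric metric_trace_P)

lemma metric_trace_h_h:
  assumes "y \<in> T p" "z \<in> T p"
  shows "metric_trace \<A> g p (\<lambda>u v. h p u z * h p y v) = 2 * \<epsilon> * h p y z"
proof -
  have "metric_trace \<A> g p (\<lambda>u v. h p u z * h p y v) = metric_trace \<A> g p (\<lambda>u v. g p u (H p z) * g p v (H p y))"
    by (rule metric_trace_cong) (simp add: g_H assms h_sym[OF assms(1)])
  also have "\<dots> = g p (H p z) (H p y)"
    by (rule metric_trace_product) (simp_all add: assms)
  also have "\<dots> = h p y (H p z)"
    using assms by (simp add: g_H h_sym[of "H p z"])
  finally show ?thesis by (simp add: h_H assms)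
qed

text \<open>The scalar curvature of \<open>\<Pi>\<close> is \<open>4n(n-1)\<close>: its Ricci tensor is
  \<open>2\<epsilon>(n-1) h\<close>, and \<open>tr P = 0\<close> gives \<open>h\<close> the trace \<open>2n\<epsilon>\<close>.\<close>

lemma scalar_curv_add_h_wedge_h:
  assumes tr: "endo_trace \<A> p (P p) = 0" and dim: "CARD('d) = 2 * n"
    and L: "\<And>x y z w. x \<in> T p \<Longrightarrow> y \<in> T p \<Longrightarrow> z \<in> T p \<Longrightarrow> w \<in> T p \<Longrightarrow>
      L' x y z w = L x y z w + a * (h p y z * h p x w - h p x z * h p y w)"
  shows "scalar_curv \<A> g p L' = scalar_curv \<A> g p L + a * (4 * real n * (real n - 1))"
proof -
  have ricci: "ricci \<A> g p L' y z = ricci \<A> g p L y z + a * (2 * \<epsilon> * (real n - 1)) * h p y z"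
    if y: "y \<in> T p" and z: "z \<in> T p" for y z
  proof -
    have "ricci \<A> g p L' y z = metric_trace \<A> g p (\<lambda>u v. 1 * L u y z v + a * (h p y z * h p u v + (-1) * (h p u z * h p y v)))"
      unfolding ricci_def by (rule metric_trace_cong) (simp add: L y z)
    also have "\<dots> = ricci \<A> g p L y z + a * (h p y z * (\<epsilon> * (2 * real n)) - 2 * \<epsilon> * h p y z)"
      unfolding metric_trace_lincomb metric_trace_h[OF tr] metric_trace_h_h[OF y z] ricci_def
      by (simp add: dim)
    finally show ?thesis by (simp add: algebra_simps)
  qed
  have "scalar_curv \<A> g p L' = metric_trace \<A> g p
      (\<lambda>y z. 1 * ricci \<A> g p L y z + a * (2 * \<epsilon> * (real n - 1)) * h p y z)"
    unfolding scalar_curv_def by (rule metric_trace_cong) (simp add: ricci)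
  also have "\<dots> = scalar_curv \<A> g p L + a * (2 * \<epsilon> * (real n - 1)) * (\<epsilon> * (2 * real n))"
    unfolding metric_trace_lincomb scalar_curv_def using metric_trace_h[OF tr] by (simp add: dim)
  finally show ?thesis by (simp add: algebra_simps)
qed

lemma A_tensor_canonical:
  assumes tr: "endo_trace \<A> p (P p) = 0" and dim: "CARD('d) = 2 * n" and n: "n \<ge> 2"
    and x: "x \<in> T p" "y \<in> T p" "z \<in> T p" "w \<in> T p"
  shows "A_tensor n \<A> P g \<epsilon> p (curvature_tensor \<A> g D' p) x y z w
    = A_tensor n \<A> P g \<epsilon> p (K_tensor \<A> P g D p) x y z w"
proof -
  obtain \<Omega> where \<Omega>: "\<Omega> \<in> T p" "\<forall>u\<in>T p. g p \<Omega> u = \<theta> p u"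
    by (rule riesz_representation[where \<alpha> = "\<theta> p", OF theta_lincomb])
  have R: "curvature_tensor \<A> g D' p x y z w = K_tensor \<A> P g D p x y z w
      + c\<^sup>2 * \<theta> p \<Omega> * (h p y z * h p x w - h p x z * h p y w)"
    if "x \<in> T p" "y \<in> T p" "z \<in> T p" "w \<in> T p" for x y z w
    using canonical_curvature[OF that \<Omega>(1)] \<Omega>(2) by simp
  have \<tau>: "scalar_curv \<A> g p (curvature_tensor \<A> g D' p)
      = scalar_curv \<A> g p (K_tensor \<A> P g D p) + c\<^sup>2 * \<theta> p \<Omega> * (4 * real n * (real n - 1))"
    by (rule scalar_curv_add_h_wedge_h[OF tr dim R])
  have cancel: "(k + a * q) - (t + a * N) * q / N = k - t * q / N" if "N \<noteq> 0" for k a q t N :: real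
    using that by (simp add: field_simps)
  show ?thesis
    unfolding A_tensor_def pi_combination[OF x] \<tau> R[OF x] by (rule cancel) (use n in simp)
qed

end

theorem theorem4p1:
  fixes \<A> :: "('m::{t2_space, second_countable_topology}, 'd::finite) chart set"
    and P :: "'m \<Rightarrow> 'm tvec \<Rightarrow> 'm tvec"
    and g :: "'m \<Rightarrow> 'm tvec \<Rightarrow> 'm tvec \<Rightarrow> real"
    and D D' :: "'m connection"
    and n :: nat
    and \<epsilon> :: real
  assumes "riemannian_almost_product \<A> P g"
    and "\<And>p. endo_trace \<A> p (P p) = 0"
    and "CARD('d) = 2 * n"
    and "n \<ge> 2"
    and "levi_civita \<A> g D"
    and "class_W3 n \<A> P g D \<and> \<epsilon> = - 1 \<or> class_W6 n \<A> P g D \<and> \<epsilon> = 1"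
    and "closed_one_form \<A> (theta \<A> P g D)"
    and "canonical_connection n \<A> P g D D'"
  shows "\<forall>p. \<forall>x\<in>tangent_space \<A> p. \<forall>y\<in>tangent_space \<A> p.
           \<forall>z\<in>tangent_space \<A> p. \<forall>w\<in>tangent_space \<A> p.
             A_tensor n \<A> P g \<epsilon> p (curvature_tensor \<A> g D' p) x y z w =
             A_tensor n \<A> P g \<epsilon> p (K_tensor \<A> P g D p) x y z w"
proof -
  have sign: "\<epsilon> * \<epsilon> = 1" using assms(6) by auto
  have theta_P: "theta \<A> P g D p (P p x) = \<epsilon> * theta \<A> P g D p x" if "x \<in> tangent_space \<A> p" for p x
    using assms(6) that by (auto simp: class_W3_def class_W6_def Let_def)
  interpret canonical_setting \<A> P g D D' n \<epsilon>
    by unfold_locales (fact assms sign theta_P)+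
  show ?thesis
    using A_tensor_canonical[OF assms(2-4)] by blast
qed

end
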